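(* Fix positive integers $i,j,n$ with $i\ne j$. Let $V^{(N)}=(v^{(N)}_{ij})$, $N\ge 1$, be a sequence of $N\times N$ COE matrices. As $N\to\infty$, $$\mathbb{E}\left[|v^{(N)}_{ij}|^{2n}\right]=n!\left(N^{-n}-\frac{n(n+1)}{2}N^{-n-1}\right)+O(N^{-n-2}).$$
   Context: An $N\times N$ COE (circular orthogonal ensemble) matrix is a random symmetric unitary matrix $V$ distributed as $V=U^{\top}U$, where $U=(u_{ij})_{1\le i,j\le N}$ is a Haar-distributed random matrix from the unitary group $U(N)$ and $U^{\top}$ is its transpose (no complex conjugation); that is, $v_{ij}=\sum_{k=1}^N u_{ki}u_{kj}$. $\mathbb{E}$ denotes expectation. The entry $v^{(N)}_{ij}$ is defined for $N\ge\max(i,j)$, and the implied constant in $O(\cdot)$ may depend on $n$. *)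

theory Defs
  imports
    "HOL-Probability.Probability"
    "HOL-Library.Landau_Symbols"
    "Jordan_Normal_Form.Schur_Decomposition"
begin

text \<open>The size \<open>N\<close> varies inside the statement, so matrices are those of
  \<open>Jordan_Normal_Form\<close> (rows and columns indexed from \<open>0\<close>).  That type carries no topology;
  the Borel algebra on the \<open>N \<times> N\<close> complex matrices is the one pulled back from
  \<open>\<complex>\<^sup>N\<^sup>\<times>\<^sup>N\<close> along the map sending a matrix to its family of entries.\<close>

definition borel_mat :: "nat \<Rightarrow> complex mat measure" where
  "borel_mat N = vimage_algebra (carrier_mat N N)
     (\<lambda>A. \<lambda>p\<in>{..<N} \<times> {..<N}. A $$ p)
     (\<Pi>\<^sub>M p\<in>{..<N} \<times> {..<N}. (borel :: complex measure))"

definition unitary_group :: "nat \<Rightarrow> complex mat set" where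
  "unitary_group N = {U \<in> carrier_mat N N.
     mat_adjoint U * U = 1\<^sub>m N \<and> U * mat_adjoint U = 1\<^sub>m N}"

text \<open>Left invariance characterises the Haar probability measure of a compact group; right
  invariance then follows and is not assumed.\<close>

definition haar_unitary :: "nat \<Rightarrow> complex mat measure \<Rightarrow> bool" where
  "haar_unitary N \<mu> \<longleftrightarrow>
     prob_space \<mu> \<and>
     space \<mu> = unitary_group N \<and>
     sets \<mu> = sets (restrict_space (borel_mat N) (unitary_group N)) \<and>
     (\<forall>W\<in>unitary_group N. distr \<mu> \<mu> (\<lambda>U. W * U) = \<mu>)"

text \<open>Here \<open>transpose_mat\<close> involves no complex conjugation.  Being a COE matrix is a property of
  the distribution, so \<open>V\<close> need not be given as \<open>U\<^sup>T U\<close> on the same probability space, and it is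
  symmetric and unitary almost surely.\<close>

definition COE :: "nat \<Rightarrow> 'a measure \<Rightarrow> ('a \<Rightarrow> complex mat) \<Rightarrow> bool" where
  "COE N M V \<longleftrightarrow>
     prob_space M \<and>
     V \<in> measurable M (borel_mat N) \<and>
     (\<exists>\<mu>. haar_unitary N \<mu> \<and>
        distr M (borel_mat N) V = distr \<mu> (borel_mat N) (\<lambda>U. transpose_mat U * U))"

end

theory Submission
  imports Defs "HOL-Real_Asymp.Real_Asymp"
begin

text \<open>Let \<open>x\<close>, \<open>y\<close> be the columns \<open>i\<close>, \<open>j\<close> of a Haar unitary matrix, \<open>v = x\<^sup>T y\<close> the entry of
  \<open>U\<^sup>T U\<close>, \<open>a = x\<^sup>T x\<close> and \<open>w = 1 - |a|\<^sup>2\<close>.  Left invariance makes the expectation of every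
  derivative along the (complexified) Lie algebra vanish, and so every polynomial vector field
  yields a relation between moments.  Two vector fields suffice: one gives
  \<open>(N - 1 + n) E (|v| ^ (2 n + 2) w ^ k) = (n + 1) E (|v| ^ (2 n) w ^ (k + 1))\<close>, the other
  \<open>(N - 1 + 2 k) E (w ^ k) = (N + 1 + 2 k) E (w ^ (k + 1))\<close>.  Together they determine
  \<open>E (|v| ^ (2 n)) = n! / (N (N + 1) \<cdots> (N + n - 2) (N + 2 n - 1))\<close>, which is then expanded in
  \<open>1 / N\<close>.\<close>

section \<open>Unitary matrices\<close>

text \<open>The obstacle is that moving \<open>y\<close> towards \<open>cnj x\<close>, the direction
  in which \<open>v\<close> grows, breaks its orthogonality to \<open>x\<close> unless
  \<open>a = 0\<close>. Only the component \<open>z = cnj x - cnj a * x\<close> orthogonal to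
  \<open>x\<close> is admissible; its squared norm is \<open>w\<close>, which is how
  \<open>w\<close> enters. The conjugate of \<open>v\<close> is the inner product of
  \<open>z\<close> with \<open>y\<close>, and given \<open>x\<close> the vector \<open>y\<close> is
  uniform on the unit sphere of a space of complex dimension \<open>N - 1\<close>. So for
  \<open>N > 2\<close> one expects |v|^2 to be \<open>w\<close> times an independent Beta(1, N - 2)
  variable, which explains the factorial and the factors N - 1, N, ... of the first relation; the
  vector field proves this without conditional distributions. The second relation closes the system:
  its solution E(w^k) = (N - 1) / (N - 1 + 2 k) says that |a|^2 is Beta(1, (N - 1) / 2) distributed.
  At k = n its numerator cancels the first factor N - 1, and its denominator is the isolated factor
  N + 2 n - 1.\<close>

lemma mat_adjoint_index:
  assumes "A \<in> carrier_mat N N" "r < N" "s < N"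
  shows "mat_adjoint A $$ (r, s) = cnj (A $$ (s, r))"
  using assms by (simp add: mat_adjoint_def mat_of_rows_def)

lemma mult_mat_index:
  assumes "A \<in> carrier_mat N N" "B \<in> carrier_mat N N" "r < N" "s < N"
  shows "(A * B) $$ (r, s) = (\<Sum>k<N. A $$ (r, k) * B $$ (k, s))"
  using assms by (simp add: scalar_prod_def lessThan_atLeast0)

lemma mat_adjoint_carrier:
  assumes "A \<in> carrier_mat N N"
  shows "mat_adjoint A \<in> carrier_mat N N"
  using assms by (simp add: mat_adjoint_def mat_of_rows_def)

lemma unitary_group_carrier: "U \<in> unitary_group N \<Longrightarrow> U \<in> carrier_mat N N"
  by (simp add: unitary_group_def)

lemma unitary_group_mult:
  assumes U: "U \<in> unitary_group N" and V: "V \<in> unitary_group N"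
  shows "U * V \<in> unitary_group N"
proof -
  have cU: "U \<in> carrier_mat N N" and cV: "V \<in> carrier_mat N N"
    using U V by (auto simp: unitary_group_def)
  note aU = mat_adjoint_carrier[OF cU] and aV = mat_adjoint_carrier[OF cV]
  have adj: "mat_adjoint (U * V) = mat_adjoint V * mat_adjoint U"
  proof (rule eq_matI)
    fix r s assume "r < dim_row (mat_adjoint V * mat_adjoint U)" "s < dim_col (mat_adjoint V * mat_adjoint U)"
    then have "r < N" "s < N" using aU aV by auto
    then show "mat_adjoint (U * V) $$ (r, s) = (mat_adjoint V * mat_adjoint U) $$ (r, s)"
      using cU cV aU aV
      by (simp add: mat_adjoint_index[OF mult_carrier_mat[OF cU cV]] mult_mat_index[OF cU cV]
          mult_mat_index[OF aV aU] mat_adjoint_index[OF cU] mat_adjoint_index[OF cV] mult.commute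
          del: index_mult_mat)
  qed (use mat_adjoint_carrier[OF mult_carrier_mat[OF cU cV]] aU aV in auto)
  have "mat_adjoint V * mat_adjoint U * (U * V) = mat_adjoint V * (mat_adjoint U * U * V)"
    by (simp only: assoc_mult_mat[OF aV aU mult_carrier_mat[OF cU cV]] assoc_mult_mat[OF aU cU cV])
  moreover have "U * V * (mat_adjoint V * mat_adjoint U) = U * (V * mat_adjoint V * mat_adjoint U)"
    by (simp only: assoc_mult_mat[OF cU cV mult_carrier_mat[OF aV aU]] assoc_mult_mat[OF cV aV aU])
  ultimately show ?thesis
    using U V mult_carrier_mat[OF cU cV] left_mult_one_mat[OF cV] left_mult_one_mat[OF aU]
    by (simp only: unitary_group_def adj mem_Collect_eq simp_thms)
qed

lemma unitary_columns_orthonormal: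
  assumes U: "U \<in> unitary_group N" and "c < N" "d < N"
  shows "(\<Sum>r<N. cnj (U $$ (r, c)) * U $$ (r, d)) = (if c = d then 1 else 0)"
proof -
  have cU: "U \<in> carrier_mat N N" using U by (rule unitary_group_carrier)
  have "(mat_adjoint U * U) $$ (c, d) = (\<Sum>r<N. cnj (U $$ (r, c)) * U $$ (r, d))"
    using assms by (simp add: mult_mat_index[OF mat_adjoint_carrier[OF cU] cU] mat_adjoint_index[OF cU]
        del: index_mult_mat)
  then show ?thesis using U assms by (auto simp: unitary_group_def)
qed

lemma unitary_entry_le_1:
  assumes U: "U \<in> unitary_group N" and "r < N" "c < N"
  shows "cmod (U $$ (r, c)) \<le> 1"
proof -
  have "complex_of_real (\<Sum>r<N. (cmod (U $$ (r, c)))\<^sup>2) = 1"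
    using unitary_columns_orthonormal[OF U \<open>c < N\<close> \<open>c < N\<close>]
    unfolding of_real_sum complex_norm_square by (simp add: mult.commute)
  then have "(\<Sum>r<N. (cmod (U $$ (r, c)))\<^sup>2) = 1"
    using of_real_eq_1_iff by blast
  moreover have "(cmod (U $$ (r, c)))\<^sup>2 \<le> (\<Sum>r<N. (cmod (U $$ (r, c)))\<^sup>2)"
    using \<open>r < N\<close> by (intro member_le_sum) auto
  ultimately show ?thesis by (simp add: abs_square_le_1)
qed

text \<open>For \<open>s = 0\<close>, where division yields \<open>0\<close>, the coefficient vanishes; this happens only for \<open>u = 0\<close>.\<close>

definition flow_coeff :: "real \<Rightarrow> real \<Rightarrow> complex" where
  "flow_coeff s t = (cis (s * t) - 1) / of_real s"

text \<open>The one-parameter unitary group \<open>exp (\<i> t u u\<^sup>*)\<close>.\<close>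

definition flow :: "nat \<Rightarrow> (nat \<Rightarrow> complex) \<Rightarrow> real \<Rightarrow> complex mat" where
  "flow N u t = mat N N (\<lambda>(r, s). (if r = s then 1 else 0)
     + flow_coeff (\<Sum>k<N. (cmod (u k))\<^sup>2) t * u r * cnj (u s))"

lemma flow_carrier: "flow N u t \<in> carrier_mat N N"
  by (simp add: flow_def)

lemma flow_coeff_0: "flow_coeff s 0 = 0"
  by (simp add: flow_coeff_def)

lemma flow_coeff_add:
  "flow_coeff s t + flow_coeff s (- t) + of_real s * flow_coeff s t * flow_coeff s (- t) = 0"
proof (cases "s = 0")
  case False
  have "cis (s * t) * cis (- (s * t)) = 1" by (simp add: cis_mult)
  with False show ?thesis
    by (simp add: flow_coeff_def field_simps)
qed (simp add: flow_coeff_def)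

text \<open>A chord is no longer than its arc. The bound is the source of all Lipschitz estimates in
  \<open>t\<close> that are uniform over the group.\<close>

lemma flow_coeff_le: "cmod (flow_coeff s t) \<le> \<bar>t\<bar>"
proof (cases "s = 0")
  case False
  have "cmod (cis (s * t) - 1) \<le> \<bar>s * t\<bar>"
  proof -
    have "cmod (cis (s * t) - 1) ^ 2 = 2 - 2 * cos (s * t)"
      unfolding cmod_power2 using sin_cos_squared_add[of "s * t"] by (simp add: power2_eq_square algebra_simps)
    also have "\<dots> = (2 * sin (s * t / 2)) ^ 2"
      using cos_double_sin[of "s * t / 2"] by (simp add: power2_eq_square)
    finally have "cmod (cis (s * t) - 1) = \<bar>2 * sin (s * t / 2)\<bar>"
      by (metis abs_norm_cancel real_sqrt_abs)
    also have "\<dots> \<le> \<bar>s * t\<bar>" using abs_sin_x_le_abs_x[of "s * t / 2"] by simp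
    finally show ?thesis .
  qed
  with False show ?thesis
    by (simp add: flow_coeff_def norm_divide divide_le_eq abs_mult mult.commute)
qed (simp add: flow_coeff_def)

lemma flow_mult_index:
  assumes "U \<in> carrier_mat N N" "r < N" "c < N"
  shows "(flow N u t * U) $$ (r, c) = U $$ (r, c)
    + flow_coeff (\<Sum>k<N. (cmod (u k))\<^sup>2) t * u r * (\<Sum>s<N. cnj (u s) * U $$ (s, c))"
proof -
  have "(flow N u t * U) $$ (r, c) = (\<Sum>k<N. (if r = k then 1 else 0) * U $$ (k, c)
      + flow_coeff (\<Sum>k<N. (cmod (u k))\<^sup>2) t * u r * (cnj (u k) * U $$ (k, c)))"
    unfolding mult_mat_index[OF flow_carrier assms]
    using assms by (intro sum.cong) (auto simp: flow_def algebra_simps)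
  also have "\<dots> = U $$ (r, c)
      + flow_coeff (\<Sum>k<N. (cmod (u k))\<^sup>2) t * u r * (\<Sum>s<N. cnj (u s) * U $$ (s, c))"
  proof -
    have "(\<Sum>k<N. (if r = k then 1 else 0) * U $$ (k, c)) = U $$ (r, c)"
      using assms by (simp add: if_distrib[of "\<lambda>x. x * _"] sum.delta cong: if_cong)
    then show ?thesis by (simp add: sum.distrib sum_distrib_left)
  qed
  finally show ?thesis .
qed

lemma flow_uminus_mult: "flow N u (- t) * flow N u t = 1\<^sub>m N"
proof (rule eq_matI)
  fix r c assume "r < dim_row (1\<^sub>m N :: complex mat)" "c < dim_col (1\<^sub>m N :: complex mat)"
  then have rc: "r < N" "c < N" by auto
  define S where "S = (\<Sum>k<N. (cmod (u k))\<^sup>2)"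
  have S: "complex_of_real S = (\<Sum>k<N. cnj (u k) * u k)"
    unfolding S_def of_real_sum complex_norm_square by (simp add: mult.commute)
  have "(\<Sum>s<N. cnj (u s) * flow N u t $$ (s, c))
      = (\<Sum>s<N. (if s = c then cnj (u s) else 0) + (cnj (u s) * u s) * (flow_coeff S t * cnj (u c)))"
    using rc by (intro sum.cong) (auto simp: flow_def S_def algebra_simps)
  also have "\<dots> = cnj (u c) + of_real S * (flow_coeff S t * cnj (u c))"
    using rc by (simp add: sum.distrib S sum_distrib_right)
  finally have "(flow N u (- t) * flow N u t) $$ (r, c) = (if r = c then 1 else 0)
      + (flow_coeff S t + flow_coeff S (- t) + of_real S * flow_coeff S t * flow_coeff S (- t)) * (u r * cnj (u c))"
    unfolding flow_mult_index[OF flow_carrier rc] using rc by (simp add: flow_def S_def algebra_simps)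
  then show "(flow N u (- t) * flow N u t) $$ (r, c) = 1\<^sub>m N $$ (r, c)"
    using rc by (simp add: flow_coeff_add)
qed (auto simp: flow_def)

lemma flow_adjoint: "mat_adjoint (flow N u t) = flow N u (- t)"
proof (rule eq_matI)
  fix r c assume "r < dim_row (flow N u (- t))" "c < dim_col (flow N u (- t))"
  then have rc: "r < N" "c < N" by (auto simp: flow_def)
  then show "mat_adjoint (flow N u t) $$ (r, c) = flow N u (- t) $$ (r, c)"
    unfolding mat_adjoint_index[OF flow_carrier rc] by (auto simp: flow_def flow_coeff_def cis_cnj)
qed (use mat_adjoint_carrier[OF flow_carrier] in \<open>auto simp: flow_def\<close>)

lemma flow_unitary: "flow N u t \<in> unitary_group N"
  using flow_uminus_mult[of N u t] flow_uminus_mult[of N u "- t"]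
  by (simp add: unitary_group_def flow_carrier flow_adjoint)

section \<open>Polarization and algebra of double sums\<close>

lemma polarization_system:
  fixes P Q R S :: complex
  assumes "P = 0" "P + Q + (R + S) = 0" "P - Q + (S - R) = 0" "P - \<i> * Q + \<i> * (R - \<i> * S) = 0"
  shows "Q = 0"
  using assms by (simp add: complex_eq_iff)

lemma double_sum_product:
  fixes f g :: "nat \<Rightarrow> complex"
  shows "(\<Sum>p<N. \<Sum>q<N. f p * g q) = (\<Sum>p<N. f p) * (\<Sum>q<N. g q)"
  by (simp add: sum_product)

lemma eq_if_diff_eq_0: "x = 0 \<Longrightarrow> x = a - b \<Longrightarrow> b = (a :: complex)"
  by simp

lemma double_sum_linear3:
  fixes f g h :: "nat \<Rightarrow> nat \<Rightarrow> complex"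
  shows "(\<Sum>p<N. \<Sum>q<N. a * f p q + b * g p q + c * h p q)
    = a * (\<Sum>p<N. \<Sum>q<N. f p q) + b * (\<Sum>p<N. \<Sum>q<N. g p q) + c * (\<Sum>p<N. \<Sum>q<N. h p q)"
  by (simp only: sum.distrib sum_distrib_left)

lemma double_sum_linear4:
  fixes f g h l :: "nat \<Rightarrow> nat \<Rightarrow> complex"
  shows "(\<Sum>p<N. \<Sum>q<N. a * f p q + b * g p q + c * h p q + d * l p q)
    = a * (\<Sum>p<N. \<Sum>q<N. f p q) + b * (\<Sum>p<N. \<Sum>q<N. g p q) + c * (\<Sum>p<N. \<Sum>q<N. h p q)
      + d * (\<Sum>p<N. \<Sum>q<N. l p q)"
  by (simp only: sum.distrib sum_distrib_left)

text \<open>For \<open>k = 0\<close> the truncated exponent \<open>k - 1\<close> gives a wrong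
  power, but the coefficient \<open>k\<close> removes the term; derivatives of powers thus need no
  case distinction.\<close>

lemma power_pred_mult: "of_nat k * w ^ (k - 1) * w = (of_nat k * w ^ k :: complex)"
  by (cases k) (auto simp: mult_ac)

section \<open>Derivatives along left translations\<close>

lemma measurable_entry:
  assumes "r < N" "c < N"
  shows "(\<lambda>U. U $$ (r, c)) \<in> borel_measurable (borel_mat N)"
proof -
  let ?P = "\<Pi>\<^sub>M p\<in>{..<N} \<times> {..<N}. (borel :: complex measure)"
  have "(\<lambda>A::complex mat. \<lambda>p\<in>{..<N} \<times> {..<N}. A $$ p) \<in> measurable (borel_mat N) ?P"
    unfolding borel_mat_def by (rule measurable_vimage_algebra1) (auto simp: space_PiM)
  moreover have "(\<lambda>x. x (r, c)) \<in> borel_measurable ?P"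
    using assms by (intro measurable_component_singleton) auto
  ultimately have "(\<lambda>A::complex mat. (\<lambda>p\<in>{..<N} \<times> {..<N}. A $$ p) (r, c)) \<in> borel_measurable (borel_mat N)"
    by (rule measurable_compose)
  with assms show ?thesis by simp
qed

lemma measurable_borel_matI:
  assumes "\<And>x. x \<in> space M \<Longrightarrow> f x \<in> carrier_mat N N"
    and "\<And>r c. r < N \<Longrightarrow> c < N \<Longrightarrow> (\<lambda>x. f x $$ (r, c)) \<in> borel_measurable M"
  shows "f \<in> measurable M (borel_mat N)"
  unfolding borel_mat_def
  by (rule measurable_vimage_algebra2) (use assms in \<open>auto intro!: measurable_restrict\<close>)

section \<open>Invariance of the Haar measure, and bounded measurable functions\<close>

locale haar =
  fixes N :: nat and \<mu> :: "complex mat measure"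
  assumes haar: "haar_unitary N \<mu>"
begin

sublocale prob_space \<mu>
  using haar by (simp add: haar_unitary_def)

lemma space_haar: "space \<mu> = unitary_group N"
  using haar by (simp add: haar_unitary_def)

lemma sets_haar: "sets \<mu> = sets (restrict_space (borel_mat N) (unitary_group N))"
  using haar by (simp add: haar_unitary_def)

lemma measurable_haarI:
  assumes "f \<in> measurable (borel_mat N) M"
  shows "f \<in> measurable \<mu> M"
  using measurable_restrict_space1[OF assms] measurable_cong_sets[OF sets_haar refl] by blast

lemma measurable_left_mult:
  assumes W: "W \<in> unitary_group N"
  shows "(\<lambda>U. W * U) \<in> measurable \<mu> \<mu>"
proof -
  have cW: "W \<in> carrier_mat N N" using W by (rule unitary_group_carrier)
  have "(\<lambda>U. W * U) \<in> measurable \<mu> (borel_mat N)"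
  proof (rule measurable_borel_matI)
    fix r c assume rc: "r < N" "c < N"
    have "(\<lambda>U. \<Sum>k<N. W $$ (r, k) * U $$ (k, c)) \<in> borel_measurable \<mu>"
      using rc by (intro borel_measurable_sum borel_measurable_times borel_measurable_const
          measurable_haarI[OF measurable_entry]) auto
    then show "(\<lambda>U. (W * U) $$ (r, c)) \<in> borel_measurable \<mu>"
      by (rule measurable_cong[THEN iffD1, rotated])
        (simp add: mult_mat_index[OF cW unitary_group_carrier rc] space_haar del: index_mult_mat)
  qed (use cW unitary_group_carrier space_haar in auto)
  then have "(\<lambda>U. W * U) \<in> measurable \<mu> (restrict_space (borel_mat N) (unitary_group N))"
    by (intro measurable_restrict_space2) (auto simp: space_haar unitary_group_mult[OF W])
  then show ?thesis using measurable_cong_sets[OF refl sets_haar] by blast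
qed

lemma integral_left_mult:
  fixes f :: "complex mat \<Rightarrow> complex"
  assumes W: "W \<in> unitary_group N" and f: "f \<in> borel_measurable \<mu>"
  shows "(\<integral>U. f (W * U) \<partial>\<mu>) = (\<integral>U. f U \<partial>\<mu>)"
  using integral_distr[OF measurable_left_mult[OF W] f] haar W
  by (simp add: haar_unitary_def)

text \<open>Unlike integrability, boundedness passes to products, so every polynomial in the entries
  and their conjugates is covered. The bound is asked for on the unitary group only, where entries
  have modulus at most 1.\<close>

definition bounded_meas :: "(complex mat \<Rightarrow> complex) \<Rightarrow> bool" where
  "bounded_meas f \<longleftrightarrow> f \<in> borel_measurable \<mu> \<and> (\<exists>B. \<forall>U\<in>unitary_group N. cmod (f U) \<le> B)"

lemma bounded_meas_integrable:
  assumes "bounded_meas f"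
  shows "integrable \<mu> f"
proof -
  obtain B where "\<forall>U\<in>unitary_group N. cmod (f U) \<le> B" and "f \<in> borel_measurable \<mu>"
    using assms unfolding bounded_meas_def by blast
  then show ?thesis by (intro integrable_const_bound[where B = B] AE_I2) (auto simp: space_haar)
qed

lemma bounded_meas_const: "bounded_meas (\<lambda>_. k)"
  unfolding bounded_meas_def by auto

lemma bounded_meas_entry: "r < N \<Longrightarrow> c < N \<Longrightarrow> bounded_meas (\<lambda>U. U $$ (r, c))"
  unfolding bounded_meas_def using unitary_entry_le_1 measurable_haarI[OF measurable_entry] by blast

lemma bounded_meas_cnj:
  assumes "bounded_meas f"
  shows "bounded_meas (\<lambda>U. cnj (f U))"
proof -
  have "cnj \<in> borel_measurable borel"
    by (intro borel_measurable_continuous_onI continuous_intros)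
  then have "(\<lambda>U. cnj (f U)) \<in> borel_measurable \<mu>" if "f \<in> borel_measurable \<mu>"
    using that by (rule measurable_compose[rotated])
  with assms show ?thesis unfolding bounded_meas_def complex_mod_cnj by blast
qed

lemma bounded_meas_uminus: "bounded_meas f \<Longrightarrow> bounded_meas (\<lambda>U. - f U)"
  unfolding bounded_meas_def norm_minus_cancel using borel_measurable_uminus by blast

lemma bounded_meas_add:
  assumes "bounded_meas f" "bounded_meas g"
  shows "bounded_meas (\<lambda>U. f U + g U)"
proof -
  obtain A B where "\<And>U. U \<in> unitary_group N \<Longrightarrow> cmod (f U) \<le> A" "\<And>U. U \<in> unitary_group N \<Longrightarrow> cmod (g U) \<le> B"
    and m: "f \<in> borel_measurable \<mu>" "g \<in> borel_measurable \<mu>"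
    using assms unfolding bounded_meas_def by blast
  then have "cmod (f U + g U) \<le> A + B" if "U \<in> unitary_group N" for U
    using that by (intro norm_triangle_mono)
  with borel_measurable_add[OF m] show ?thesis unfolding bounded_meas_def by blast
qed

lemma bounded_meas_mult:
  assumes "bounded_meas f" "bounded_meas g"
  shows "bounded_meas (\<lambda>U. f U * g U)"
proof -
  obtain A B where AB: "\<And>U. U \<in> unitary_group N \<Longrightarrow> cmod (f U) \<le> A"
      "\<And>U. U \<in> unitary_group N \<Longrightarrow> cmod (g U) \<le> B"
    and m: "f \<in> borel_measurable \<mu>" "g \<in> borel_measurable \<mu>"
    using assms unfolding bounded_meas_def by blast
  have "cmod (f U * g U) \<le> A * B" if "U \<in> unitary_group N" for U
    unfolding norm_mult using AB[OF that] order_trans[OF norm_ge_zero AB(1)[OF that]]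
    by (intro mult_mono) simp_all
  with borel_measurable_times[OF m] show ?thesis unfolding bounded_meas_def by blast
qed

lemma bounded_meas_power:
  assumes "bounded_meas f"
  shows "bounded_meas (\<lambda>U. f U ^ n)"
  using bounded_meas_mult[OF assms] by (induction n) (simp_all add: bounded_meas_const)

text \<open>\<open>left_deriv f G\<close> states that \<open>G p q\<close> is the derivative of \<open>f\<close> in the direction of the
  elementary matrix \<open>E\<^sub>p\<^sub>q\<close> acting from the left, in the complexified Lie algebra of the unitary
  group.  Only the rank one directions \<open>\<i> u u\<^sup>*\<close> belong to the Lie algebra itself; they span it.\<close>

definition left_deriv :: "(complex mat \<Rightarrow> complex) \<Rightarrow> (nat \<Rightarrow> nat \<Rightarrow> complex mat \<Rightarrow> complex) \<Rightarrow> bool" where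
  "left_deriv f G \<longleftrightarrow> bounded_meas f \<and> (\<forall>p<N. \<forall>q<N. bounded_meas (G p q)) \<and>
     (\<forall>u. \<exists>B. \<forall>U\<in>unitary_group N. \<forall>t. cmod (f (flow N u t * U) - f U) \<le> B * \<bar>t\<bar>) \<and>
     (\<forall>u. \<forall>U\<in>unitary_group N. ((\<lambda>t. f (flow N u t * U)) has_vector_derivative
        \<i> * (\<Sum>p<N. \<Sum>q<N. u p * cnj (u q) * G p q U)) (at 0))"

lemma left_deriv_bounded_meas:
  assumes "left_deriv f G"
  shows "bounded_meas f" and "\<And>p q. p < N \<Longrightarrow> q < N \<Longrightarrow> bounded_meas (G p q)"
  using assms unfolding left_deriv_def by blast+

lemma flow_0_mult:
  assumes "U \<in> unitary_group N"
  shows "flow N u 0 * U = U"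
proof -
  have "flow N u 0 = 1\<^sub>m N" by (rule eq_matI) (auto simp: flow_def flow_coeff_0)
  with assms show ?thesis using unitary_group_carrier[OF assms] by simp
qed

lemma left_deriv_const: "left_deriv (\<lambda>_. k) (\<lambda>_ _ _. 0)"
  unfolding left_deriv_def by (auto intro: bounded_meas_const exI[of _ 0])

lemma left_deriv_add:
  assumes "left_deriv f F" "left_deriv g G"
  shows "left_deriv (\<lambda>U. f U + g U) (\<lambda>p q U. F p q U + G p q U)"
  unfolding left_deriv_def
proof (intro conjI allI impI ballI)
  fix u
  obtain A B where "\<forall>U\<in>unitary_group N. \<forall>t. cmod (f (flow N u t * U) - f U) \<le> A * \<bar>t\<bar>"
    "\<forall>U\<in>unitary_group N. \<forall>t. cmod (g (flow N u t * U) - g U) \<le> B * \<bar>t\<bar>"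
    using assms unfolding left_deriv_def by meson
  then show "\<exists>B. \<forall>U\<in>unitary_group N. \<forall>t. cmod (f (flow N u t * U) + g (flow N u t * U) - (f U + g U)) \<le> B * \<bar>t\<bar>"
    by (intro exI[of _ "A + B"]) (auto simp: add_diff_add distrib_right intro!: norm_triangle_mono)
next
  fix u U assume "U \<in> unitary_group N"
  then have "((\<lambda>t. f (flow N u t * U)) has_vector_derivative \<i> * (\<Sum>p<N. \<Sum>q<N. u p * cnj (u q) * F p q U)) (at 0)"
    "((\<lambda>t. g (flow N u t * U)) has_vector_derivative \<i> * (\<Sum>p<N. \<Sum>q<N. u p * cnj (u q) * G p q U)) (at 0)"
    using assms unfolding left_deriv_def by blast+
  from has_vector_derivative_add[OF this]
  show "((\<lambda>t. f (flow N u t * U) + g (flow N u t * U)) has_vector_derivative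
      \<i> * (\<Sum>p<N. \<Sum>q<N. u p * cnj (u q) * (F p q U + G p q U))) (at 0)"
    by (simp add: sum.distrib distrib_left)
qed (auto intro!: bounded_meas_add left_deriv_bounded_meas[OF assms(1)] left_deriv_bounded_meas[OF assms(2)])

text \<open>Besides the product rule, the uniform Lipschitz bound has to carry over to products.
  This uses that both factors are bounded on the group, which is why \<open>left_deriv\<close>
  includes boundedness.\<close>

lemma left_deriv_mult:
  assumes "left_deriv f F" "left_deriv g G"
  shows "left_deriv (\<lambda>U. f U * g U) (\<lambda>p q U. F p q U * g U + f U * G p q U)"
  unfolding left_deriv_def
proof (intro conjI allI impI ballI)
  fix u
  obtain A B where AB: "\<forall>U\<in>unitary_group N. \<forall>t. cmod (f (flow N u t * U) - f U) \<le> A * \<bar>t\<bar>"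
    "\<forall>U\<in>unitary_group N. \<forall>t. cmod (g (flow N u t * U) - g U) \<le> B * \<bar>t\<bar>"
    using assms unfolding left_deriv_def by meson
  obtain C D where CD: "\<forall>U\<in>unitary_group N. cmod (f U) \<le> C" "\<forall>U\<in>unitary_group N. cmod (g U) \<le> D"
    using assms unfolding left_deriv_def bounded_meas_def by blast
  have "cmod (f (flow N u t * U) * g (flow N u t * U) - f U * g U) \<le> (A * D + C * B) * \<bar>t\<bar>"
    if U: "U \<in> unitary_group N" for U t
  proof -
    let ?W = "flow N u t * U"
    have W: "?W \<in> unitary_group N" using U by (intro unitary_group_mult flow_unitary)
    have "f ?W * g ?W - f U * g U = (f ?W - f U) * g ?W + f U * (g ?W - g U)"
      by (simp add: algebra_simps)
    moreover have "cmod ((f ?W - f U) * g ?W) \<le> (A * \<bar>t\<bar>) * D"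
      unfolding norm_mult using AB CD U W by (intro mult_mono) (auto intro: order_trans[OF norm_ge_zero])
    moreover have "cmod (f U * (g ?W - g U)) \<le> C * (B * \<bar>t\<bar>)"
      unfolding norm_mult using AB CD U W by (intro mult_mono) (auto intro: order_trans[OF norm_ge_zero])
    ultimately have "cmod (f ?W * g ?W - f U * g U) \<le> (A * \<bar>t\<bar>) * D + C * (B * \<bar>t\<bar>)"
      by (metis norm_triangle_mono)
    then show ?thesis by (simp add: algebra_simps)
  qed
  then show "\<exists>B. \<forall>U\<in>unitary_group N. \<forall>t. cmod (f (flow N u t * U) * g (flow N u t * U) - f U * g U) \<le> B * \<bar>t\<bar>"
    by blast
next
  fix u U assume U: "U \<in> unitary_group N"
  then have "((\<lambda>t. f (flow N u t * U)) has_vector_derivative \<i> * (\<Sum>p<N. \<Sum>q<N. u p * cnj (u q) * F p q U)) (at 0)"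
    "((\<lambda>t. g (flow N u t * U)) has_vector_derivative \<i> * (\<Sum>p<N. \<Sum>q<N. u p * cnj (u q) * G p q U)) (at 0)"
    using assms unfolding left_deriv_def by blast+
  from has_vector_derivative_mult[OF this]
  have "((\<lambda>t. f (flow N u t * U) * g (flow N u t * U)) has_vector_derivative
      f U * (\<i> * (\<Sum>p<N. \<Sum>q<N. u p * cnj (u q) * G p q U))
      + \<i> * (\<Sum>p<N. \<Sum>q<N. u p * cnj (u q) * F p q U) * g U) (at 0)"
    unfolding flow_0_mult[OF U] .
  also have "(f U * (\<i> * (\<Sum>p<N. \<Sum>q<N. u p * cnj (u q) * G p q U))
      + \<i> * (\<Sum>p<N. \<Sum>q<N. u p * cnj (u q) * F p q U) * g U)
      = \<i> * ((\<Sum>p<N. \<Sum>q<N. u p * cnj (u q) * F p q U) * g U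
          + f U * (\<Sum>p<N. \<Sum>q<N. u p * cnj (u q) * G p q U))"
    by (simp only: distrib_left mult.assoc mult.left_commute add.commute)
  also have "\<dots> = \<i> * (\<Sum>p<N. \<Sum>q<N. u p * cnj (u q) * F p q U * g U + f U * (u p * cnj (u q) * G p q U))"
    by (simp only: sum.distrib sum_distrib_left sum_distrib_right)
  also have "\<dots> = \<i> * (\<Sum>p<N. \<Sum>q<N. u p * cnj (u q) * (F p q U * g U + f U * G p q U))"
    by (intro arg_cong2[of _ _ _ _ "(*)"] sum.cong refl) (simp add: algebra_simps)
  finally show "((\<lambda>t. f (flow N u t * U) * g (flow N u t * U)) has_vector_derivative
      \<i> * (\<Sum>p<N. \<Sum>q<N. u p * cnj (u q) * (F p q U * g U + f U * G p q U))) (at 0)" .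
qed (auto intro!: bounded_meas_add bounded_meas_mult left_deriv_bounded_meas[OF assms(1)] left_deriv_bounded_meas[OF assms(2)])

lemma left_deriv_cong:
  assumes "left_deriv f F" "\<And>U. f U = g U" "\<And>p q U. p < N \<Longrightarrow> q < N \<Longrightarrow> F p q U = G p q U"
  shows "left_deriv g G"
proof -
  have "g = f" using assms(2) by auto
  moreover have "F p q = G p q" if "p < N" "q < N" for p q using assms(3)[OF that] by auto
  ultimately show ?thesis using assms(1) unfolding left_deriv_def by simp
qed

lemma left_deriv_diff:
  assumes "left_deriv f F" "left_deriv g G"
  shows "left_deriv (\<lambda>U. f U - g U) (\<lambda>p q U. F p q U - G p q U)"
  by (rule left_deriv_cong[OF left_deriv_add[OF assms(1) left_deriv_mult[OF left_deriv_const[of "-1"] assms(2)]]]) auto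

lemma left_deriv_sum:
  assumes "\<And>k. k \<in> A \<Longrightarrow> left_deriv (f k) (F k)"
  shows "left_deriv (\<lambda>U. \<Sum>k\<in>A. f k U) (\<lambda>p q U. \<Sum>k\<in>A. F k p q U)"
  using assms by (induction A rule: infinite_finite_induct) (auto intro: left_deriv_const left_deriv_add)

lemma left_deriv_power:
  assumes "left_deriv f F"
  shows "left_deriv (\<lambda>U. f U ^ n) (\<lambda>p q U. of_nat n * f U ^ (n - 1) * F p q U)"
proof (induction n)
  case (Suc n)
  show ?case
  proof (rule left_deriv_cong[OF left_deriv_mult[OF assms Suc]])
    show "F p q U * f U ^ n + f U * (of_nat n * f U ^ (n - 1) * F p q U)
        = of_nat (Suc n) * f U ^ (Suc n - 1) * F p q U" for p q U
      by (cases n) (simp_all add: algebra_simps)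
  qed simp
qed (simp add: left_deriv_const)

lemma flow_coeff_deriv:
  assumes "s \<noteq> 0"
  shows "(flow_coeff s has_vector_derivative \<i>) (at 0)"
proof -
  have "((\<lambda>t. (cis (s * t) - 1) / complex_of_real s) has_vector_derivative (s *\<^sub>R (\<i> * cis (s * 0))) / of_real s) (at 0)"
    unfolding cis_conv_exp
    by (auto intro!: derivative_eq_intros has_vector_derivative_real_field simp: scaleR_conv_of_real)
  with assms show ?thesis by (simp add: flow_coeff_def[abs_def] scaleR_conv_of_real)
qed

lemma left_deriv_entry:
  assumes r: "r < N" and c: "c < N"
  shows "left_deriv (\<lambda>U. U $$ (r, c)) (\<lambda>p q U. if r = p then U $$ (q, c) else 0)"
  unfolding left_deriv_def
proof (intro conjI allI impI ballI)
  fix u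
  define B where "B = cmod (u r) * (\<Sum>s<N. cmod (u s))"
  have "cmod ((flow N u t * U) $$ (r, c) - U $$ (r, c)) \<le> B * \<bar>t\<bar>" if U: "U \<in> unitary_group N" for U t
  proof -
    have "cmod (\<Sum>s<N. cnj (u s) * U $$ (s, c)) \<le> (\<Sum>s<N. cmod (u s))"
      by (rule order_trans[OF norm_sum], rule sum_mono)
        (use unitary_entry_le_1[OF U _ c] in \<open>auto simp: norm_mult mult_left_le\<close>)
    then have "cmod (flow_coeff (\<Sum>k<N. (cmod (u k))\<^sup>2) t * u r * (\<Sum>s<N. cnj (u s) * U $$ (s, c)))
        \<le> \<bar>t\<bar> * cmod (u r) * (\<Sum>s<N. cmod (u s))"
      unfolding norm_mult by (intro mult_mono flow_coeff_le) (auto intro: mult_nonneg_nonneg)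
    then show ?thesis
      by (simp add: flow_mult_index[OF unitary_group_carrier[OF U] r c] B_def mult_ac del: index_mult_mat)
  qed
  then show "\<exists>B. \<forall>U\<in>unitary_group N. \<forall>t. cmod ((flow N u t * U) $$ (r, c) - U $$ (r, c)) \<le> B * \<bar>t\<bar>"
    by blast
next
  fix u U assume U: "U \<in> unitary_group N"
  define S where "S = (\<Sum>k<N. (cmod (u k))\<^sup>2)"
  define D where "D = u r * (\<Sum>s<N. cnj (u s) * U $$ (s, c))"
  have "((\<lambda>t. U $$ (r, c) + flow_coeff S t * D) has_vector_derivative \<i> * D) (at 0)"
  \<comment> \<open>For \<open>S = 0\<close> the coefficient has derivative 0 instead of the
    imaginary unit, but then \<open>u\<close> vanishes below \<open>N\<close> and \<open>D\<close>
    is 0.\<close>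
  proof (cases "S = 0")
    case True
    then have "u r = 0"
      using r sum_nonneg_eq_0_iff[of "{..<N}" "\<lambda>k. (cmod (u k))\<^sup>2"] by (auto simp: S_def)
    then show ?thesis by (simp add: D_def)
  next
    case False
    show ?thesis by (auto intro!: derivative_eq_intros flow_coeff_deriv[OF False])
  qed
  moreover have "\<i> * D = \<i> * (\<Sum>p<N. \<Sum>q<N. u p * cnj (u q) * (if r = p then U $$ (q, c) else 0))"
  proof -
    have "(\<Sum>q<N. u p * cnj (u q) * (if r = p then U $$ (q, c) else 0)) = (if p = r then D else 0)" for p
      by (auto simp: D_def sum_distrib_left mult_ac)
    with r show ?thesis by simp
  qed
  ultimately show "((\<lambda>t. (flow N u t * U) $$ (r, c)) has_vector_derivative
      \<i> * (\<Sum>p<N. \<Sum>q<N. u p * cnj (u q) * (if r = p then U $$ (q, c) else 0))) (at 0)"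
    by (simp add: flow_mult_index[OF unitary_group_carrier[OF U] r c] D_def S_def mult_ac del: index_mult_mat)
next
  fix p q assume "p < N" "q < N"
  with c show "bounded_meas (\<lambda>U. if r = p then U $$ (q, c) else 0)"
    by (cases "r = p") (auto intro: bounded_meas_entry bounded_meas_const)
qed (use r c in \<open>auto intro: bounded_meas_entry\<close>)

text \<open>Complex conjugation exchanges the two indices, as \<open>E\<^sub>p\<^sub>q\<close> is the adjoint of \<open>E\<^sub>q\<^sub>p\<close> and
  the Lie algebra consists of antihermitian matrices.\<close>

lemma left_deriv_cnj:
  assumes f: "left_deriv f F"
  shows "left_deriv (\<lambda>U. cnj (f U)) (\<lambda>p q U. - cnj (F q p U))"
  unfolding left_deriv_def
proof (intro conjI allI impI ballI)
  fix u
  show "\<exists>B. \<forall>U\<in>unitary_group N. \<forall>t. cmod (cnj (f (flow N u t * U)) - cnj (f U)) \<le> B * \<bar>t\<bar>"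
    using f unfolding left_deriv_def complex_cnj_diff[symmetric] complex_mod_cnj by blast
next
  fix u U assume "U \<in> unitary_group N"
  then have "((\<lambda>t. f (flow N u t * U)) has_vector_derivative \<i> * (\<Sum>p<N. \<Sum>q<N. u p * cnj (u q) * F p q U)) (at 0)"
    using f unfolding left_deriv_def by blast
  from has_vector_derivative_cnj[OF this]
  have "((\<lambda>t. cnj (f (flow N u t * U))) has_vector_derivative
      cnj (\<i> * (\<Sum>p<N. \<Sum>q<N. u p * cnj (u q) * F p q U))) (at 0)" .
  also have "cnj (\<i> * (\<Sum>p<N. \<Sum>q<N. u p * cnj (u q) * F p q U))
      = \<i> * (\<Sum>q<N. \<Sum>p<N. u q * cnj (u p) * - cnj (F p q U))"
    by (subst sum.swap) (simp add: sum_negf mult_ac)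
  finally show "((\<lambda>t. cnj (f (flow N u t * U))) has_vector_derivative
      \<i> * (\<Sum>p<N. \<Sum>q<N. u p * cnj (u q) * - cnj (F q p U))) (at 0)" .
qed (auto intro!: bounded_meas_cnj bounded_meas_uminus left_deriv_bounded_meas[OF f])

section \<open>Derivatives have mean zero\<close>

lemma integral_left_deriv_rank_one:
  assumes f: "left_deriv f G"
  shows "(\<integral>U. (\<Sum>p<N. \<Sum>q<N. u p * cnj (u q) * G p q U) \<partial>\<mu>) = 0"
proof -
  define D where "D = (\<lambda>U. \<i> * (\<Sum>p<N. \<Sum>q<N. u p * cnj (u q) * G p q U))"
  define t :: "nat \<Rightarrow> real" where "t = (\<lambda>n. 1 / real (Suc n))"
  define s where "s = (\<lambda>n U. (f (flow N u (t n) * U) - f U) / of_real (t n))"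
  have tpos: "t n > 0" for n by (simp add: t_def)
  have t0: "t \<longlonglongrightarrow> 0" unfolding t_def by (rule LIMSEQ_Suc[OF lim_1_over_n])
  obtain B where B: "\<forall>U\<in>unitary_group N. \<forall>t. cmod (f (flow N u t * U) - f U) \<le> B * \<bar>t\<bar>"
    using f unfolding left_deriv_def by meson
  have f': "f \<in> borel_measurable \<mu>" "integrable \<mu> f"
    using f bounded_meas_integrable unfolding left_deriv_def bounded_meas_def by blast+
  have fW: "(\<lambda>U. f (flow N u (t n) * U)) \<in> borel_measurable \<mu>" for n
    using measurable_compose[OF measurable_left_mult[OF flow_unitary] f'(1)] .
  have ifW: "integrable \<mu> (\<lambda>U. f (flow N u (t n) * U))" for n
  proof -
    obtain C where "\<forall>U\<in>unitary_group N. cmod (f U) \<le> C"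
      using f unfolding left_deriv_def bounded_meas_def by blast
    then show ?thesis
      using unitary_group_mult[OF flow_unitary]
      by (intro integrable_const_bound[where B = C] fW) (auto simp: space_haar)
  qed
  \<comment> \<open>The difference quotients \<open>s n\<close> have integral 0 by left invariance,
    converge pointwise to the derivative \<open>D\<close>, and are dominated by the Lipschitz
    constant \<open>B\<close>, which does not depend on \<open>U\<close>.\<close>
  have "(\<lambda>n. \<integral>U. s n U \<partial>\<mu>) \<longlonglongrightarrow> (\<integral>U. D U \<partial>\<mu>)"
  proof (rule integral_dominated_convergence[where w = "\<lambda>_. B"])
    show "D \<in> borel_measurable \<mu>"
      using f unfolding D_def left_deriv_def bounded_meas_def
      by (intro borel_measurable_times borel_measurable_sum borel_measurable_const) auto
    show "s n \<in> borel_measurable \<mu>" for n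
      unfolding s_def by (intro borel_measurable_divide borel_measurable_diff fW f' borel_measurable_const)
    show "AE U in \<mu>. norm (s n U) \<le> B" for n
    proof (rule AE_I2)
      fix U assume "U \<in> space \<mu>"
      then have "cmod (f (flow N u (t n) * U) - f U) \<le> B * t n"
        using B[rule_format, of U "t n"] tpos[of n] by (simp add: space_haar)
      then show "norm (s n U) \<le> B" using tpos[of n] by (simp add: s_def norm_divide divide_le_eq)
    qed
    show "AE U in \<mu>. (\<lambda>n. s n U) \<longlonglongrightarrow> D U"
    proof (rule AE_I2)
      fix U assume "U \<in> space \<mu>"
      then have U: "U \<in> unitary_group N" by (simp add: space_haar)
      then have "((\<lambda>t. f (flow N u t * U)) has_vector_derivative D U) (at 0)"
        using f unfolding left_deriv_def D_def by blast
      then have "((\<lambda>h. (1 / \<bar>h\<bar>) *\<^sub>R (f (flow N u h * U) - (f (flow N u 0 * U) + h *\<^sub>R D U))) \<longlongrightarrow> 0) (at 0)"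
        by (simp add: has_vector_derivative_def has_derivative_within)
      then have "(\<lambda>n. (1 / \<bar>t n\<bar>) *\<^sub>R (f (flow N u (t n) * U) - (f (flow N u 0 * U) + t n *\<^sub>R D U))) \<longlonglongrightarrow> 0"
        by (rule filterlim_compose) (use t0 tpos in \<open>auto simp: filterlim_at less_imp_neq[symmetric]\<close>)
      moreover have "(1 / \<bar>t n\<bar>) *\<^sub>R (f (flow N u (t n) * U) - (f (flow N u 0 * U) + t n *\<^sub>R D U)) = s n U - D U" for n
        using tpos[of n] by (simp add: s_def flow_0_mult[OF U] scaleR_conv_of_real right_diff_distrib
            diff_divide_distrib distrib_left add_divide_distrib)
      ultimately have "(\<lambda>n. s n U - D U) \<longlonglongrightarrow> 0" by simp
      then show "(\<lambda>n. s n U) \<longlonglongrightarrow> D U" using Lim_null by blast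
    qed
  qed simp
  moreover have "(\<integral>U. s n U \<partial>\<mu>) = 0" for n
    unfolding s_def by (simp add: ifW f' integral_left_mult[OF flow_unitary f'(1)])
  ultimately have "(\<integral>U. D U \<partial>\<mu>) = 0" by (simp add: LIMSEQ_const_iff)
  then show ?thesis by (simp add: D_def)
qed

text \<open>The integrals form a matrix whose sesquilinear form vanishes at every vector
  \<open>u\<close> by the rank one case. Over the complex numbers such a form is zero, by
  polarization. This reaches directions outside the real Lie algebra, as the vector fields below
  require.\<close>

lemma integral_left_deriv:
  assumes f: "left_deriv f G" and p: "p < N" and q: "q < N"
  shows "(\<integral>U. G p q U \<partial>\<mu>) = 0"
proof -
  define e where "e = (\<lambda>p q. \<integral>U. G p q U \<partial>\<mu>)"
  have iG: "integrable \<mu> (G p q)" if "p < N" "q < N" for p q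
    using f that bounded_meas_integrable unfolding left_deriv_def by blast
  have form: "(\<Sum>p<N. \<Sum>q<N. u p * cnj (u q) * e p q) = 0" for u
  proof -
    have "(\<integral>U. (\<Sum>p<N. \<Sum>q<N. u p * cnj (u q) * G p q U) \<partial>\<mu>)
        = (\<Sum>p<N. \<integral>U. (\<Sum>q<N. u p * cnj (u q) * G p q U) \<partial>\<mu>)"
      using iG by (subst Bochner_Integration.integral_sum) auto
    also have "\<dots> = (\<Sum>p<N. \<Sum>q<N. \<integral>U. u p * cnj (u q) * G p q U \<partial>\<mu>)"
      using iG by (auto intro!: sum.cong Bochner_Integration.integral_sum)
    also have "\<dots> = (\<Sum>p<N. \<Sum>q<N. u p * cnj (u q) * e p q)"
      by (simp add: e_def)
    finally have "(\<integral>U. (\<Sum>p<N. \<Sum>q<N. u p * cnj (u q) * G p q U) \<partial>\<mu>) = (\<Sum>p<N. \<Sum>q<N. u p * cnj (u q) * e p q)" .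
    then show ?thesis using integral_left_deriv_rank_one[OF f] by simp
  qed
  \<comment> \<open>The weights are the coordinates of e_p + c e_q; written as a sum of two
    indicators they remain correct for \<open>p = q\<close>.\<close>
  have two: "(\<Sum>k<N. ((if k = p then 1 else 0) + c * (if k = q then 1 else 0)) * X k) = X p + c * X q"
    for c :: complex and X
  proof -
    have "(\<Sum>k<N. ((if k = p then 1 else 0) + c * (if k = q then 1 else 0)) * X k)
        = (\<Sum>k<N. (if k = p then X k else 0) + (if k = q then c * X k else 0))"
      by (intro sum.cong) (auto simp: distrib_right)
    also have "\<dots> = X p + c * X q" using p q by (simp add: sum.distrib)
    finally show ?thesis .
  qed
  have eq: "e p p + cnj c * e p q + c * (e q p + cnj c * e q q) = 0" for c
  proof -
    define u where "u = (\<lambda>k. (if k = p then 1 else 0) + c * (if k = q then 1 else 0))"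
    have cu: "cnj (u k) = (if k = p then 1 else 0) + cnj c * (if k = q then 1 else 0)" for k
      by (simp add: u_def)
    have "0 = (\<Sum>k<N. u k * (\<Sum>l<N. cnj (u l) * e k l))"
      using form[of u] by (simp add: sum_distrib_left mult.assoc)
    also have "\<dots> = e p p + cnj c * e p q + c * (e q p + cnj c * e q q)"
      unfolding cu two unfolding u_def two ..
    finally show ?thesis ..
  qed
  \<comment> \<open>The form is evaluated at e_p + c e_q for c = 0, 1, -1 and the imaginary unit.
    The middle two values give \<open>e q q = 0\<close> and \<open>e p q + e q p = 0\<close>; the
    last one gives \<open>e p q = e q p\<close>.\<close>
  have "e p p = 0" using eq[of 0] by simp
  moreover have "e p p + e p q + (e q p + e q q) = 0" using eq[of 1] by simp
  moreover have "e p p - e p q + (e q q - e q p) = 0" using eq[of "-1"] by simp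
  moreover have "e p p - \<i> * e p q + \<i> * (e q p - \<i> * e q q) = 0" using eq[of \<i>] by simp
  ultimately have "e p q = 0"
    by (rule polarization_system)
  then show ?thesis by (simp add: e_def)
qed

section \<open>Moment recursions\<close>

text \<open>A divergence theorem for the vector field with coefficients \<open>C p q\<close>,
  multiplied by \<open>f\<close>. Each product \<open>C p q U * f U\<close> is differentiated in its
  own direction \<open>p\<close>, \<open>q\<close>, so the diagonal terms \<open>K p q p q\<close>
  add up to the divergence of the field and the terms \<open>C p q U * F p q U\<close> to the
  derivative of \<open>f\<close> along it.\<close>

lemma integral_divergence:
  assumes C: "\<And>p q. p < N \<Longrightarrow> q < N \<Longrightarrow> left_deriv (C p q) (K p q)" and f: "left_deriv f F"
  shows "(\<integral>U. (\<Sum>p<N. \<Sum>q<N. K p q p q U * f U + C p q U * F p q U) \<partial>\<mu>) = 0"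
proof -
  have ld: "left_deriv (\<lambda>U. C p q U * f U) (\<lambda>p' q' U. K p q p' q' U * f U + C p q U * F p' q' U)"
    if "p < N" "q < N" for p q
    using left_deriv_mult[OF C[OF that] f] .
  define H where "H = (\<lambda>p q U. K p q p q U * f U + C p q U * F p q U)"
  have H: "integrable \<mu> (H p q)" "(\<integral>U. H p q U \<partial>\<mu>) = 0" if "p < N" "q < N" for p q
    unfolding H_def using bounded_meas_integrable[OF left_deriv_bounded_meas(2)[OF ld[OF that] that]]
      integral_left_deriv[OF ld[OF that] that] by simp_all
  have "(\<integral>U. (\<Sum>p<N. \<Sum>q<N. H p q U) \<partial>\<mu>) = (\<Sum>p<N. \<integral>U. (\<Sum>q<N. H p q U) \<partial>\<mu>)"
    using H by (subst Bochner_Integration.integral_sum) auto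
  also have "\<dots> = (\<Sum>p<N. \<Sum>q<N. \<integral>U. H p q U \<partial>\<mu>)"
    using H by (auto intro!: sum.cong Bochner_Integration.integral_sum)
  also have "\<dots> = 0" using H by simp
  finally show ?thesis by (simp add: H_def)
qed

text \<open>The entry \<open>(c, d)\<close> of \<open>U\<^sup>T U\<close>.\<close>

definition gram :: "nat \<Rightarrow> nat \<Rightarrow> complex mat \<Rightarrow> complex" where
  "gram c d U = (\<Sum>r<N. U $$ (r, c) * U $$ (r, d))"

lemma left_deriv_gram:
  assumes "c < N" "d < N"
  shows "left_deriv (gram c d) (\<lambda>p q U. U $$ (q, c) * U $$ (p, d) + U $$ (p, c) * U $$ (q, d))"
proof -
  have "left_deriv (\<lambda>U. \<Sum>r<N. U $$ (r, c) * U $$ (r, d))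
    (\<lambda>p q U. \<Sum>r<N. (if r = p then U $$ (q, c) else 0) * U $$ (r, d) + U $$ (r, c) * (if r = p then U $$ (q, d) else 0))"
    using assms by (intro left_deriv_sum left_deriv_mult left_deriv_entry) auto
  then show ?thesis
  proof (rule left_deriv_cong)
    fix p q and U :: "complex mat" assume "p < N" "q < N"
    have "(\<Sum>r<N. (if r = p then U $$ (q, c) else 0) * U $$ (r, d) + U $$ (r, c) * (if r = p then U $$ (q, d) else 0))
      = (\<Sum>r<N. if r = p then U $$ (q, c) * U $$ (p, d) + U $$ (p, c) * U $$ (q, d) else 0)"
      by (intro sum.cong) auto
    with \<open>p < N\<close> show "(\<Sum>r<N. (if r = p then U $$ (q, c) else 0) * U $$ (r, d) + U $$ (r, c) * (if r = p then U $$ (q, d) else 0))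
      = U $$ (q, c) * U $$ (p, d) + U $$ (p, c) * U $$ (q, d)" by simp
  qed (simp add: gram_def)
qed

text \<open>Its values are real, but the type is complex because \<open>left_deriv\<close> concerns
  complex functions. On unitary matrices it measures how far the column is from being real up to a
  phase.\<close>

definition defect :: "nat \<Rightarrow> complex mat \<Rightarrow> complex" where
  "defect c U = 1 - gram c c U * cnj (gram c c U)"

lemma left_deriv_defect:
  assumes "c < N"
  shows "left_deriv (defect c) (\<lambda>p q U. 2 * gram c c U * (cnj (U $$ (p, c)) * cnj (U $$ (q, c)))
    - 2 * cnj (gram c c U) * (U $$ (p, c) * U $$ (q, c)))"
  by (rule left_deriv_cong[OF left_deriv_diff[OF left_deriv_const left_deriv_mult[OF
    left_deriv_gram[OF assms assms] left_deriv_cnj[OF left_deriv_gram[OF assms assms]]]]])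
    (auto simp: defect_def algebra_simps)

lemma bounded_meas_gram: "c < N \<Longrightarrow> d < N \<Longrightarrow> bounded_meas (gram c d)"
  by (rule left_deriv_bounded_meas(1)[OF left_deriv_gram])

lemma bounded_meas_defect: "c < N \<Longrightarrow> bounded_meas (defect c)"
  by (rule left_deriv_bounded_meas(1)[OF left_deriv_defect])

text \<open>The vector field is \<open>C = cnj x x\<^sup>*\<close> with \<open>x\<close> the column \<open>c\<close>, applied to \<open>a w ^ k\<close>.\<close>

lemma defect_moment_step:
  assumes c: "c < N"
  shows "(of_nat N - 1 + 2 * of_nat k) * (\<integral>U. defect c U ^ k \<partial>\<mu>)
    = (of_nat N + 1 + 2 * of_nat k) * (\<integral>U. defect c U ^ Suc k \<partial>\<mu>)"
proof -
  let ?a = "gram c c" and ?w = "defect c"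
  let ?C = "\<lambda>p q U. cnj (U $$ (p, c)) * cnj (U $$ (q, c))"
  let ?K = "\<lambda>p q p' q' U. (if p = q' then - cnj (U $$ (p', c)) else 0) * cnj (U $$ (q, c))
    + cnj (U $$ (p, c)) * (if q = q' then - cnj (U $$ (p', c)) else 0)"
  let ?Fa = "\<lambda>p q U. 2 * (U $$ (p, c) * U $$ (q, c))"
  let ?Fw = "\<lambda>p q U. 2 * ?a U * (cnj (U $$ (p, c)) * cnj (U $$ (q, c))) - 2 * cnj (?a U) * (U $$ (p, c) * U $$ (q, c))"
  \<comment> \<open>The divergence of the field is a multiple of \<open>cnj a\<close>. The factor
    \<open>a\<close> balances its phase, so that only |a|^2 = 1 - w remains.\<close>
  let ?f = "\<lambda>U. ?a U * ?w U ^ k"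
  let ?F = "\<lambda>p q U. ?Fa p q U * ?w U ^ k + ?a U * (of_nat k * ?w U ^ (k - 1) * ?Fw p q U)"
  have cnj_entry: "left_deriv (\<lambda>U. cnj (U $$ (r, c))) (\<lambda>p q U. if r = q then - cnj (U $$ (p, c)) else 0)" if "r < N" for r
    by (rule left_deriv_cong[OF left_deriv_cnj[OF left_deriv_entry[OF that c]]]) auto
  have C: "left_deriv (?C p q) (?K p q)" if "p < N" "q < N" for p q
    by (rule left_deriv_mult[OF cnj_entry[OF that(1)] cnj_entry[OF that(2)]])
  have a: "left_deriv ?a ?Fa"
    by (rule left_deriv_cong[OF left_deriv_gram[OF c c]]) auto
  have f: "left_deriv ?f ?F"
    by (rule left_deriv_mult[OF a left_deriv_power[OF left_deriv_defect[OF c]]])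
  have pt: "(\<Sum>p<N. \<Sum>q<N. ?K p q p q U * ?f U + ?C p q U * ?F p q U)
    = (of_nat N + 1 + 2 * of_nat k) * ?w U ^ Suc k - (of_nat N - 1 + 2 * of_nat k) * ?w U ^ k"
    if U: "U \<in> unitary_group N" for U
  proof -
    define x where "x = (\<lambda>r. U $$ (r, c))"
    define A where "A = ?a U"
    define W where "W = ?w U"
    have A: "(\<Sum>r<N. x r * x r) = A" by (simp add: A_def gram_def x_def)
    have cA: "(\<Sum>r<N. cnj (x r) * cnj (x r)) = cnj A" by (simp flip: A)
    have one: "(\<Sum>r<N. cnj (x r) * x r) = 1"
      using unitary_columns_orthonormal[OF U c c] by (simp add: x_def)
    have W: "W = 1 - A * cnj A" by (simp add: W_def defect_def A_def)
    \<comment> \<open>Differentiating the second factor contributes for every pair \<open>p\<close>,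
      \<open>q\<close>, which gives \<open>N\<close> copies of \<open>- cnj A\<close>; the first
      factor contributes only for \<open>p = q\<close>, which gives one more.\<close>
    have K: "(\<Sum>p<N. \<Sum>q<N. ?K p q p q U) = - (of_nat N + 1) * cnj A"
    proof -
      have "(\<Sum>p<N. \<Sum>q<N. ?K p q p q U)
        = (\<Sum>p<N. \<Sum>q<N. (if p = q then - (cnj (x p) * cnj (x p)) else 0) + - (cnj (x p) * cnj (x p)))"
        by (intro sum.cong) (auto simp: x_def)
      also have "\<dots> = (\<Sum>p<N. - (cnj (x p) * cnj (x p)) - of_nat N * (cnj (x p) * cnj (x p)))"
        by (intro sum.cong refl) (simp only: sum.distrib, simp)
      also have "\<dots> = - cnj A - of_nat N * cnj A"
        by (simp only: sum_subtractf sum_negf cA flip: sum_distrib_left)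
      finally show ?thesis by (simp add: algebra_simps)
    qed
    have Ca: "(\<Sum>p<N. \<Sum>q<N. ?C p q U * ?Fa p q U) = 2"
    proof -
      have "(\<Sum>p<N. \<Sum>q<N. ?C p q U * ?Fa p q U) = (\<Sum>p<N. \<Sum>q<N. (2 * (cnj (x p) * x p)) * (cnj (x q) * x q))"
        by (intro sum.cong refl) (simp add: x_def)
      also have "\<dots> = 2" by (simp only: double_sum_product one) (simp add: one flip: sum_distrib_left)
      finally show ?thesis .
    qed
    have Cw: "(\<Sum>p<N. \<Sum>q<N. ?C p q U * ?Fw p q U) = - 2 * cnj A * W"
    proof -
      have "(\<Sum>p<N. \<Sum>q<N. ?C p q U * ?Fw p q U) = (\<Sum>p<N. \<Sum>q<N.
          (2 * A * (cnj (x p) * cnj (x p))) * (cnj (x q) * cnj (x q)) - (2 * cnj A * (cnj (x p) * x p)) * (cnj (x q) * x q))"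
        by (intro sum.cong refl) (simp add: x_def A_def algebra_simps)
      also have "\<dots> = 2 * A * cnj A * cnj A - 2 * cnj A"
        by (simp only: sum_subtractf double_sum_product one cA) (simp add: one cA flip: sum_distrib_left)
      finally show ?thesis by (simp add: W algebra_simps)
    qed
    have "(\<Sum>p<N. \<Sum>q<N. ?K p q p q U * ?f U + ?C p q U * ?F p q U)
      = (\<Sum>p<N. \<Sum>q<N. ?f U * ?K p q p q U + W ^ k * (?C p q U * ?Fa p q U)
          + (A * (of_nat k * W ^ (k - 1))) * (?C p q U * ?Fw p q U))"
      by (intro sum.cong refl) (simp only: A_def W_def, simp only: ring_distribs mult_ac add_ac)
    also have "\<dots> = ?f U * (\<Sum>p<N. \<Sum>q<N. ?K p q p q U) + W ^ k * (\<Sum>p<N. \<Sum>q<N. ?C p q U * ?Fa p q U)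
          + (A * (of_nat k * W ^ (k - 1))) * (\<Sum>p<N. \<Sum>q<N. ?C p q U * ?Fw p q U)"
      by (rule double_sum_linear3)
    also have "\<dots> = - (of_nat N + 1) * (A * cnj A) * W ^ k + 2 * W ^ k - 2 * (A * cnj A) * (of_nat k * W ^ (k - 1) * W)"
      unfolding K Ca Cw by (simp add: A_def W_def mult_ac)
    also have "A * cnj A = 1 - W" by (simp add: W)
    also have "of_nat k * W ^ (k - 1) * W = of_nat k * W ^ k" by (rule power_pred_mult)
    finally show ?thesis by (simp add: W_def algebra_simps)
  qed
  have int: "integrable \<mu> (\<lambda>U. ?w U ^ j)" for j
    by (rule bounded_meas_integrable[OF bounded_meas_power[OF bounded_meas_defect[OF c]]])
  have "(\<integral>U. (of_nat N + 1 + 2 * of_nat k) * ?w U ^ Suc k - (of_nat N - 1 + 2 * of_nat k) * ?w U ^ k \<partial>\<mu>) = 0"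
    by (rule trans[OF Bochner_Integration.integral_cong[OF refl pt[symmetric]] integral_divergence[OF C f]])
      (simp_all only: space_haar)
  moreover have "(\<integral>U. (of_nat N + 1 + 2 * of_nat k) * ?w U ^ Suc k - (of_nat N - 1 + 2 * of_nat k) * ?w U ^ k \<partial>\<mu>)
    = (of_nat N + 1 + 2 * of_nat k) * (\<integral>U. ?w U ^ Suc k \<partial>\<mu>) - (of_nat N - 1 + 2 * of_nat k) * (\<integral>U. ?w U ^ k \<partial>\<mu>)"
    by (subst Bochner_Integration.integral_diff, (rule integrable_mult_right int)+,
        simp only: integral_mult_right_zero)
  ultimately show ?thesis by (rule eq_if_diff_eq_0)
qed

text \<open>With \<open>x\<close>, \<open>y\<close> the columns \<open>c\<close>, \<open>d\<close> and \<open>z\<close> the projection of \<open>cnj x\<close> to the orthogonal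
  complement of \<open>x\<close>, the vector field \<open>C = z y\<^sup>*\<close> fixes \<open>x\<close>, hence \<open>w\<close>, and moves \<open>y\<close> in the direction \<open>z\<close>.\<close>

lemma gram_defect_moment_step:
  assumes c: "c < N" and d: "d < N" and cd: "c \<noteq> d"
  shows "(of_nat N - 1 + of_nat n) * (\<integral>U. (gram c d U * cnj (gram c d U)) ^ Suc n * defect c U ^ k \<partial>\<mu>)
    = of_nat (Suc n) * (\<integral>U. (gram c d U * cnj (gram c d U)) ^ n * defect c U ^ Suc k \<partial>\<mu>)"
proof -
  let ?a = "gram c c" and ?w = "defect c" and ?v = "gram c d"
  let ?z = "\<lambda>p U. cnj (U $$ (p, c)) - cnj (?a U) * U $$ (p, c)"
  let ?C = "\<lambda>p q U. ?z p U * cnj (U $$ (q, d))"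
  let ?Kz = "\<lambda>p p' q' U. (if p = q' then - cnj (U $$ (p', c)) else 0)
    - ((- 2 * (cnj (U $$ (p', c)) * cnj (U $$ (q', c)))) * U $$ (p, c) + cnj (?a U) * (if p = p' then U $$ (q', c) else 0))"
  let ?K = "\<lambda>p q p' q' U. ?Kz p p' q' U * cnj (U $$ (q, d))
    + ?z p U * (if q = q' then - cnj (U $$ (p', d)) else 0)"
  let ?Fv = "\<lambda>p q U. U $$ (q, c) * U $$ (p, d) + U $$ (p, c) * U $$ (q, d)"
  let ?Fcv = "\<lambda>p q U. - cnj (?Fv q p U)"
  let ?Fw = "\<lambda>p q U. 2 * ?a U * (cnj (U $$ (p, c)) * cnj (U $$ (q, c))) - 2 * cnj (?a U) * (U $$ (p, c) * U $$ (q, c))"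
  \<comment> \<open>The surplus factor \<open>v\<close> balances the phase of the field, whose
    divergence is a multiple of \<open>cnj v\<close>; every surviving term becomes a power of |v|^2
    times a power of \<open>w\<close>.\<close>
  let ?f = "\<lambda>U. ?v U ^ Suc n * cnj (?v U) ^ n * ?w U ^ k"
  let ?F = "\<lambda>p q U. (of_nat (Suc n) * ?v U ^ (Suc n - 1) * ?Fv p q U * cnj (?v U) ^ n
      + ?v U ^ Suc n * (of_nat n * cnj (?v U) ^ (n - 1) * ?Fcv p q U)) * ?w U ^ k
      + ?v U ^ Suc n * cnj (?v U) ^ n * (of_nat k * ?w U ^ (k - 1) * ?Fw p q U)"
  have cnj_entry: "left_deriv (\<lambda>U. cnj (U $$ (r, e))) (\<lambda>p q U. if r = q then - cnj (U $$ (p, e)) else 0)"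
    if "r < N" "e < N" for r e
    by (rule left_deriv_cong[OF left_deriv_cnj[OF left_deriv_entry[OF that]]]) auto
  have ca: "left_deriv (\<lambda>U. cnj (?a U)) (\<lambda>p q U. - 2 * (cnj (U $$ (p, c)) * cnj (U $$ (q, c))))"
    by (rule left_deriv_cong[OF left_deriv_cnj[OF left_deriv_gram[OF c c]]]) auto
  have C: "left_deriv (?C p q) (?K p q)" if "p < N" "q < N" for p q
    by (rule left_deriv_mult[OF left_deriv_diff[OF cnj_entry[OF that(1) c]
        left_deriv_mult[OF ca left_deriv_entry[OF that(1) c]]] cnj_entry[OF that(2) d]])
  have v: "left_deriv ?v ?Fv" by (rule left_deriv_gram[OF c d])
  have f: "left_deriv ?f ?F"
    by (rule left_deriv_mult[OF left_deriv_mult[OF left_deriv_power[OF v] left_deriv_power[OF left_deriv_cnj[OF v]]]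
        left_deriv_power[OF left_deriv_defect[OF c]]])
  have pt: "(\<Sum>p<N. \<Sum>q<N. ?K p q p q U * ?f U + ?C p q U * ?F p q U)
    = of_nat (Suc n) * ((?v U * cnj (?v U)) ^ n * ?w U ^ Suc k)
      - (of_nat N - 1 + of_nat n) * ((?v U * cnj (?v U)) ^ Suc n * ?w U ^ k)"
    if U: "U \<in> unitary_group N" for U
  proof -
    define x where "x = (\<lambda>r. U $$ (r, c))"
    define y where "y = (\<lambda>r. U $$ (r, d))"
    define A where "A = ?a U"
    define V where "V = ?v U"
    define W where "W = ?w U"
    define z where "z = (\<lambda>r. cnj (x r) - cnj A * x r)"
    have A: "(\<Sum>r<N. x r * x r) = A" by (simp add: A_def gram_def x_def)
    have cA: "(\<Sum>r<N. cnj (x r) * cnj (x r)) = cnj A" by (simp flip: A)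
    have V: "(\<Sum>r<N. x r * y r) = V" by (simp add: V_def gram_def x_def y_def)
    have cV: "(\<Sum>r<N. cnj (x r) * cnj (y r)) = cnj V" by (simp flip: V)
    have xx: "(\<Sum>r<N. cnj (x r) * x r) = 1" and yy: "(\<Sum>r<N. cnj (y r) * y r) = 1"
      and yx: "(\<Sum>r<N. cnj (y r) * x r) = 0"
      using unitary_columns_orthonormal[OF U c c] unitary_columns_orthonormal[OF U d d]
        unitary_columns_orthonormal[OF U d c] cd by (simp_all add: x_def y_def)
    have W: "W = 1 - A * cnj A" by (simp add: W_def defect_def A_def)
    have zx: "(\<Sum>r<N. z r * x r) = W"
    proof -
      have "(\<Sum>r<N. z r * x r) = (\<Sum>r<N. cnj (x r) * x r - cnj A * (x r * x r))"
        by (simp add: z_def algebra_simps)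
      then show ?thesis by (simp add: sum_subtractf xx A W flip: sum_distrib_left)
    qed
    \<comment> \<open>Conjugated columns move by minus the transpose of \<open>C\<close>. Hence
      \<open>z\<close> being orthogonal to \<open>x\<close> is what keeps \<open>cnj x\<close>
      fixed, while \<open>yx\<close> keeps \<open>x\<close> itself fixed.\<close>
    have zcx: "(\<Sum>r<N. z r * cnj (x r)) = 0"
    proof -
      have "(\<Sum>r<N. z r * cnj (x r)) = (\<Sum>r<N. cnj (x r) * cnj (x r) - cnj A * (cnj (x r) * x r))"
        by (simp add: z_def algebra_simps)
      then show ?thesis by (simp add: sum_subtractf xx cA flip: sum_distrib_left)
    qed
    have zcy: "(\<Sum>r<N. z r * cnj (y r)) = cnj V"
    proof -
      have "(\<Sum>r<N. z r * cnj (y r)) = (\<Sum>r<N. cnj (x r) * cnj (y r) - cnj A * (cnj (y r) * x r))"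
        by (simp add: z_def algebra_simps)
      then show ?thesis by (simp add: sum_subtractf yx cV flip: sum_distrib_left)
    qed
    \<comment> \<open>The contributions are \<open>- cnj V\<close> from \<open>cnj x\<close> in
      \<open>z\<close>, \<open>2 * cnj V\<close> from \<open>cnj a\<close>, 0 from the remaining
      \<open>x\<close>, and \<open>- N * cnj V\<close> from the factor \<open>cnj y\<close>.\<close>
    have K: "(\<Sum>p<N. \<Sum>q<N. ?K p q p q U) = (1 - of_nat N) * cnj V"
    proof -
      have "(\<Sum>p<N. \<Sum>q<N. ?K p q p q U)
        = (\<Sum>p<N. \<Sum>q<N. (if p = q then - (cnj (x p) * cnj (y p)) else 0)
            + (2 * (cnj (x p) * x p)) * (cnj (x q) * cnj (y q))
            - (cnj A * (cnj (y q) * x q) + z p * cnj (y p)))"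
        by (intro sum.cong refl) (auto simp: x_def y_def z_def A_def algebra_simps)
      also have "\<dots> = (\<Sum>p<N. \<Sum>q<N. if p = q then - (cnj (x p) * cnj (y p)) else 0)
          + (\<Sum>p<N. \<Sum>q<N. (2 * (cnj (x p) * x p)) * (cnj (x q) * cnj (y q)))
          - ((\<Sum>p<N. \<Sum>q<N. cnj A * (cnj (y q) * x q)) + (\<Sum>p<N. \<Sum>q<N. z p * cnj (y p)))"
        by (simp only: sum_subtractf sum.distrib)
      also have "(\<Sum>p<N. \<Sum>q<N. (2 * (cnj (x p) * x p)) * (cnj (x q) * cnj (y q))) = 2 * cnj V"
        by (simp only: double_sum_product cV) (simp add: xx flip: sum_distrib_left)
      also have "(\<Sum>p<N. \<Sum>q<N. cnj A * (cnj (y q) * x q)) = 0"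
        by (simp add: yx flip: sum_distrib_left)
      also have "(\<Sum>p<N. \<Sum>q<N. z p * cnj (y p)) = of_nat N * cnj V"
        by (simp add: zcy flip: sum_distrib_left)
      also have "(\<Sum>p<N. \<Sum>q<N. if p = q then - (cnj (x p) * cnj (y p)) else 0) = - cnj V"
        by (simp add: sum_negf cV)
      finally show ?thesis by (simp add: algebra_simps)
    qed
    have Cv: "(\<Sum>p<N. \<Sum>q<N. ?C p q U * ?Fv p q U) = W"
    proof -
      have "(\<Sum>p<N. \<Sum>q<N. ?C p q U * ?Fv p q U)
        = (\<Sum>p<N. \<Sum>q<N. (z p * y p) * (cnj (y q) * x q) + (z p * x p) * (cnj (y q) * y q))"
        by (intro sum.cong refl) (simp add: x_def y_def z_def A_def algebra_simps)
      also have "\<dots> = W" by (simp only: sum.distrib double_sum_product yx yy zx) simp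
      finally show ?thesis .
    qed
    \<comment> \<open>The field also turns \<open>cnj y\<close> into \<open>- cnj V * cnj y\<close>.
      This is the origin of the summand \<open>n\<close> in the factor
      \<open>N - 1 + n\<close>.\<close>
    have Ccv: "(\<Sum>p<N. \<Sum>q<N. ?C p q U * ?Fcv p q U) = - (cnj V * cnj V)"
    proof -
      have "(\<Sum>p<N. \<Sum>q<N. ?C p q U * ?Fcv p q U)
        = (\<Sum>p<N. \<Sum>q<N. - ((z p * cnj (x p)) * (cnj (y q) * cnj (y q)) + (z p * cnj (y p)) * (cnj (x q) * cnj (y q))))"
        by (intro sum.cong refl) (simp add: x_def y_def z_def A_def algebra_simps)
      also have "\<dots> = - (cnj V * cnj V)"
        by (simp only: sum_negf sum.distrib double_sum_product zcx zcy cV) simp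
      finally show ?thesis .
    qed
    have Cw: "(\<Sum>p<N. \<Sum>q<N. ?C p q U * ?Fw p q U) = 0"
    proof -
      have "(\<Sum>p<N. \<Sum>q<N. ?C p q U * ?Fw p q U)
        = (\<Sum>p<N. \<Sum>q<N. (z p * cnj (x p)) * (2 * A * cnj (x q) * cnj (y q)) - (2 * cnj A * z p * x p) * (cnj (y q) * x q))"
        by (intro sum.cong refl) (simp add: x_def y_def z_def A_def algebra_simps)
      also have "\<dots> = 0"
        by (simp only: sum_subtractf double_sum_product zcx yx) simp
      finally show ?thesis .
    qed
    have "(\<Sum>p<N. \<Sum>q<N. ?K p q p q U * ?f U + ?C p q U * ?F p q U)
      = (\<Sum>p<N. \<Sum>q<N. ?f U * ?K p q p q U + (of_nat (Suc n) * V ^ n * cnj V ^ n * W ^ k) * (?C p q U * ?Fv p q U)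
          + (V ^ Suc n * (of_nat n * cnj V ^ (n - 1)) * W ^ k) * (?C p q U * ?Fcv p q U)
          + (V ^ Suc n * cnj V ^ n * (of_nat k * W ^ (k - 1))) * (?C p q U * ?Fw p q U))"
    proof (intro sum.cong refl)
      fix p q
      \<comment> \<open>The derivatives and powers are treated as opaque letters, so that the
        regrouping does not expand them.\<close>
      have *: "K * f + C * ((s * v1 * Fv * cn + v2 * (nn * c1 * Fc)) * wk + v2 * cn * (kk * w1 * Fw))
        = f * K + (s * v1 * cn * wk) * (C * Fv) + (v2 * (nn * c1) * wk) * (C * Fc) + (v2 * cn * (kk * w1)) * (C * Fw)"
        for K f C s v1 Fv cn v2 nn c1 Fc wk kk w1 Fw :: complex
        by (simp add: algebra_simps)
      show "?K p q p q U * ?f U + ?C p q U * ?F p q U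
        = ?f U * ?K p q p q U + (of_nat (Suc n) * V ^ n * cnj V ^ n * W ^ k) * (?C p q U * ?Fv p q U)
          + (V ^ Suc n * (of_nat n * cnj V ^ (n - 1)) * W ^ k) * (?C p q U * ?Fcv p q U)
          + (V ^ Suc n * cnj V ^ n * (of_nat k * W ^ (k - 1))) * (?C p q U * ?Fw p q U)"
        unfolding V_def W_def diff_Suc_1 by (rule *)
    qed
    also have "\<dots> = ?f U * (\<Sum>p<N. \<Sum>q<N. ?K p q p q U)
          + (of_nat (Suc n) * V ^ n * cnj V ^ n * W ^ k) * (\<Sum>p<N. \<Sum>q<N. ?C p q U * ?Fv p q U)
          + (V ^ Suc n * (of_nat n * cnj V ^ (n - 1)) * W ^ k) * (\<Sum>p<N. \<Sum>q<N. ?C p q U * ?Fcv p q U)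
          + (V ^ Suc n * cnj V ^ n * (of_nat k * W ^ (k - 1))) * (\<Sum>p<N. \<Sum>q<N. ?C p q U * ?Fw p q U)"
      by (rule double_sum_linear4)
    also have "\<dots> = of_nat (Suc n) * ((V * cnj V) ^ n * W ^ Suc k)
        + (1 - of_nat N) * ((V * cnj V) ^ Suc n * W ^ k)
        - V ^ Suc n * W ^ k * cnj V * (of_nat n * cnj V ^ (n - 1) * cnj V)"
      unfolding K Cv Ccv Cw by (simp add: V_def W_def power_mult_distrib algebra_simps)
    also have "of_nat n * cnj V ^ (n - 1) * cnj V = of_nat n * cnj V ^ n" by (rule power_pred_mult)
    finally show ?thesis by (simp add: V_def W_def power_mult_distrib algebra_simps)
  qed
  have int: "integrable \<mu> (\<lambda>U. (?v U * cnj (?v U)) ^ i * ?w U ^ j)" for i j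
    using c d by (intro bounded_meas_integrable bounded_meas_mult bounded_meas_power bounded_meas_cnj
        bounded_meas_gram bounded_meas_defect)
  have "(\<integral>U. of_nat (Suc n) * ((?v U * cnj (?v U)) ^ n * ?w U ^ Suc k)
      - (of_nat N - 1 + of_nat n) * ((?v U * cnj (?v U)) ^ Suc n * ?w U ^ k) \<partial>\<mu>) = 0"
    by (rule trans[OF Bochner_Integration.integral_cong[OF refl pt[symmetric]] integral_divergence[OF C f]])
      (simp_all only: space_haar)
  moreover have "(\<integral>U. of_nat (Suc n) * ((?v U * cnj (?v U)) ^ n * ?w U ^ Suc k)
      - (of_nat N - 1 + of_nat n) * ((?v U * cnj (?v U)) ^ Suc n * ?w U ^ k) \<partial>\<mu>)
    = of_nat (Suc n) * (\<integral>U. (?v U * cnj (?v U)) ^ n * ?w U ^ Suc k \<partial>\<mu>)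
      - (of_nat N - 1 + of_nat n) * (\<integral>U. (?v U * cnj (?v U)) ^ Suc n * ?w U ^ k \<partial>\<mu>)"
    by (subst Bochner_Integration.integral_diff, (rule integrable_mult_right int)+,
        simp only: integral_mult_right_zero)
  ultimately show ?thesis by (rule eq_if_diff_eq_0)
qed

section \<open>Closed form of the moments\<close>

lemma defect_moment:
  assumes c: "c < N"
  shows "(of_nat N - 1 + 2 * of_nat k) * (\<integral>U. defect c U ^ k \<partial>\<mu>) = of_nat N - 1"
proof (induction k)
  case 0
  show ?case by (simp add: prob_space)
next
  case (Suc k)
  \<comment> \<open>As N + 1 + 2 k = N - 1 + 2 (k + 1), the recursion says that the left-hand side
    does not depend on \<open>k\<close>.\<close>
  have "(of_nat N - 1 + 2 * of_nat (Suc k)) * (\<integral>U. defect c U ^ Suc k \<partial>\<mu>)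
    = (of_nat N + 1 + 2 * of_nat k) * (\<integral>U. defect c U ^ Suc k \<partial>\<mu>)"
    by (simp add: algebra_simps del: power_Suc)
  then show ?case by (simp only: defect_moment_step[OF c, symmetric] Suc)
qed

text \<open>Each step trades one factor |v|^2 for one factor \<open>w\<close>; the exponent
  \<open>k\<close> grows along the way and has to be arbitrary in the induction.\<close>

lemma gram_defect_moment:
  assumes cd: "c < N" "d < N" "c \<noteq> d"
  shows "(\<Prod>m<n. of_nat N - 1 + of_nat m) * (\<integral>U. (gram c d U * cnj (gram c d U)) ^ n * defect c U ^ k \<partial>\<mu>)
    = fact n * (\<integral>U. defect c U ^ (k + n) \<partial>\<mu>)"
proof (induction n arbitrary: k)
  case (Suc n)
  define P :: complex where "P = (\<Prod>m<n. of_nat N - 1 + of_nat m)"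
  have "(\<Prod>m<Suc n. of_nat N - 1 + of_nat m) * (\<integral>U. (gram c d U * cnj (gram c d U)) ^ Suc n * defect c U ^ k \<partial>\<mu>)
    = P * ((of_nat N - 1 + of_nat n) * (\<integral>U. (gram c d U * cnj (gram c d U)) ^ Suc n * defect c U ^ k \<partial>\<mu>))"
    by (simp only: P_def prod.lessThan_Suc mult.assoc)
  also have "\<dots> = of_nat (Suc n) * (P * (\<integral>U. (gram c d U * cnj (gram c d U)) ^ n * defect c U ^ Suc k \<partial>\<mu>))"
    by (simp only: gram_defect_moment_step[OF cd] mult.left_commute)
  also have "\<dots> = of_nat (Suc n) * (fact n * (\<integral>U. defect c U ^ (Suc k + n) \<partial>\<mu>))"
    unfolding P_def Suc.IH ..
  finally show ?case by (simp only: fact_Suc mult.assoc add_Suc add_Suc_right of_nat_mult)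
qed simp

lemma gram_abs_moment:
  assumes cd: "c < N" "d < N" "c \<noteq> d"
  shows "(\<integral>U. cmod (gram c d U) ^ (2 * Suc n) \<partial>\<mu>)
    = fact (Suc n) / ((\<Prod>m<n. real N + real m) * (real N + real (2 * n + 1)))"
proof -
  define E where "E = (\<integral>U. cmod (gram c d U) ^ (2 * Suc n) \<partial>\<mu>)"
  define P where "P = (\<Prod>m<n. real N + real m)"
  \<comment> \<open>Two distinct indices below \<open>N\<close> force N >= 2, so the common factor
    \<open>N - 1\<close> can be cancelled.\<close>
  have N: "real N - 1 > 0" using cd by linarith
  have "complex_of_real E = (\<integral>U. (gram c d U * cnj (gram c d U)) ^ Suc n * defect c U ^ 0 \<partial>\<mu>)"
    unfolding E_def integral_complex_of_real[symmetric]
    by (simp only: power_mult of_real_power complex_norm_square[symmetric] power_0 mult_1_right)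
  then have eq: "(\<Prod>m<Suc n. of_nat N - 1 + of_nat m) * complex_of_real E = fact (Suc n) * (\<integral>U. defect c U ^ Suc n \<partial>\<mu>)"
    using gram_defect_moment[OF cd, of "Suc n" 0] by (simp only: add_0_left)
  have "(of_nat N - 1 + 2 * of_nat (Suc n)) * ((\<Prod>m<Suc n. of_nat N - 1 + of_nat m) * complex_of_real E)
      = fact (Suc n) * ((of_nat N - 1 + 2 * of_nat (Suc n)) * (\<integral>U. defect c U ^ Suc n \<partial>\<mu>))"
    unfolding eq by (rule mult.left_commute)
  also have "\<dots> = fact (Suc n) * (of_nat N - 1)" unfolding defect_moment[OF cd(1)] ..
  finally have "(of_nat N - 1 + 2 * of_nat (Suc n)) * ((\<Prod>m<Suc n. of_nat N - 1 + of_nat m) * complex_of_real E)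
      = fact (Suc n) * (of_nat N - 1)" .
  then have "complex_of_real ((real N - 1 + 2 * real (Suc n)) * ((\<Prod>m<Suc n. real N - 1 + real m) * E))
      = complex_of_real (fact (Suc n) * (real N - 1))"
    by (simp only: of_real_mult of_real_add of_real_diff of_real_prod of_real_of_nat_eq of_real_1 of_real_numeral of_real_fact)
  then have "(real N - 1 + 2 * real (Suc n)) * ((\<Prod>m<Suc n. real N - 1 + real m) * E) = fact (Suc n) * (real N - 1)"
    by (simp only: of_real_eq_iff)
  moreover have "real N - 1 + 2 * real (Suc n) = real N + real (2 * n + 1)" by simp
  \<comment> \<open>Splitting off the factor for m = 0, which the numerator of E(w^(n + 1)) cancels,
    shifts the remaining factors to start at \<open>N\<close>.\<close>
  moreover have "(\<Prod>m<Suc n. real N - 1 + real m) = (real N - 1) * P"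
    by (simp only: prod.lessThan_Suc_shift P_def) (simp add: add_ac)
  ultimately have "(real N - 1) * ((real N + real (2 * n + 1)) * P * E) = (real N - 1) * fact (Suc n)"
    by (simp only: mult_ac)
  then have "(real N + real (2 * n + 1)) * P * E = fact (Suc n)" using N by (simp only: mult_cancel_left) simp
  moreover have "(real N + real (2 * n + 1)) * P \<noteq> 0" using N by (simp add: P_def)
  ultimately show ?thesis unfolding E_def[symmetric] P_def[symmetric]
    by (simp add: eq_divide_eq mult_ac)
qed

end

section \<open>Transfer from the Haar measure to COE matrices\<close>

lemma COE_offdiagonal_moment:
  assumes COE: "COE N M V" and cd: "c < N" "d < N" "c \<noteq> d"
  shows "(\<integral>\<omega>. cmod (V \<omega> $$ (c, d)) ^ (2 * Suc n) \<partial>M)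
    = fact (Suc n) / ((\<Prod>m<n. real N + real m) * (real N + real (2 * n + 1)))"
proof -
  obtain \<mu> where haar: "haar_unitary N \<mu>" and V: "V \<in> measurable M (borel_mat N)"
    and distr: "distr M (borel_mat N) V = distr \<mu> (borel_mat N) (\<lambda>U. transpose_mat U * U)"
    using COE unfolding COE_def by blast
  interpret haar N \<mu> by unfold_locales (rule haar)
  have gram: "(transpose_mat U * U) $$ (r, s) = gram r s U" if "U \<in> unitary_group N" "r < N" "s < N" for U r s
    using unitary_group_carrier[OF that(1)] that(2,3)
    by (subst mult_mat_index[of _ N]) (auto simp: gram_def intro!: sum.cong)
  have T: "(\<lambda>U. transpose_mat U * U) \<in> measurable \<mu> (borel_mat N)"
  proof (rule measurable_borel_matI)
    show "transpose_mat U * U \<in> carrier_mat N N" if "U \<in> space \<mu>" for U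
      using unitary_group_carrier[of U N] that by (simp add: space_haar)
    fix r s assume rs: "r < N" "s < N"
    have "gram r s \<in> borel_measurable \<mu>"
      using bounded_meas_gram[OF rs] by (simp add: bounded_meas_def)
    then show "(\<lambda>U. (transpose_mat U * U) $$ (r, s)) \<in> borel_measurable \<mu>"
      by (rule measurable_cong[THEN iffD2, rotated]) (simp only: gram rs space_haar)
  qed
  have f: "(\<lambda>A. cmod (A $$ (c, d)) ^ (2 * Suc n)) \<in> borel_measurable (borel_mat N)"
    by (rule borel_measurable_power[OF measurable_compose[OF measurable_entry[OF cd(1) cd(2)] borel_measurable_norm]])
  have "(\<integral>\<omega>. cmod (V \<omega> $$ (c, d)) ^ (2 * Suc n) \<partial>M)
      = (\<integral>U. cmod ((transpose_mat U * U) $$ (c, d)) ^ (2 * Suc n) \<partial>\<mu>)"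
    unfolding integral_distr[OF V f, symmetric] integral_distr[OF T f, symmetric] distr ..
  also have "\<dots> = (\<integral>U. cmod (gram c d U) ^ (2 * Suc n) \<partial>\<mu>)"
    by (intro Bochner_Integration.integral_cong refl) (simp only: gram cd space_haar)
  finally show ?thesis unfolding gram_abs_moment[OF cd] .
qed

section \<open>Expansion in \<open>1 / N\<close>\<close>

text \<open>Since 1 / (N + c) = 1/N - c/N^2 + O(1/N^3), dividing by \<open>N + c\<close> adds
  \<open>c\<close> to the second coefficient.\<close>

lemma expansion_divide_shift:
  fixes g :: "nat \<Rightarrow> real"
  assumes g: "(\<lambda>N. g N - (1 / real N ^ k - s / real N ^ (k + 1))) \<in> O(\<lambda>N. 1 / real N ^ (k + 2))"
  shows "(\<lambda>N. g N / (real N + c) - (1 / real N ^ (k + 1) - (s + c) / real N ^ (k + 2))) \<in> O(\<lambda>N. 1 / real N ^ (k + 3))"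
proof -
  have shift: "(\<lambda>N. 1 / (real N + c)) \<in> O(\<lambda>N. 1 / real N)" by real_asymp
  have "(\<lambda>N. (g N - (1 / real N ^ k - s / real N ^ (k + 1))) * (1 / (real N + c)))
      \<in> O(\<lambda>N. 1 / real N ^ (k + 2) * (1 / real N))"
    by (rule landau_o.big.mult[OF g shift])
  \<comment> \<open>This is the exact remainder when the two-term expansion is divided by
    \<open>N + c\<close>.\<close>
  moreover have "(\<lambda>N. c * (s + c) * (1 / real N ^ (k + 2) * (1 / (real N + c))))
      \<in> O(\<lambda>N. 1 / real N ^ (k + 2) * (1 / real N))"
  proof -
    have "(\<lambda>N. 1 / real N ^ (k + 2) * (1 / (real N + c))) \<in> O(\<lambda>N. 1 / real N ^ (k + 2) * (1 / real N))"
      by (rule landau_o.big.mult[OF landau_o.big_refl shift])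
    then show ?thesis by (cases "c * (s + c) = 0") (simp_all only: mult_zero_left zero_in_bigo landau_o.big.cmult_in_iff not_False_eq_True)
  qed
  ultimately have "(\<lambda>N. (g N - (1 / real N ^ k - s / real N ^ (k + 1))) * (1 / (real N + c))
      + c * (s + c) * (1 / real N ^ (k + 2) * (1 / (real N + c)))) \<in> O(\<lambda>N. 1 / real N ^ (k + 2) * (1 / real N))"
    by (rule sum_in_bigo)
  also have "(\<lambda>N. 1 / real N ^ (k + 2) * (1 / real N)) = (\<lambda>N. 1 / real N ^ (k + 3))"
    by (simp add: eval_nat_numeral mult_ac)
  finally have R: "(\<lambda>N. (g N - (1 / real N ^ k - s / real N ^ (k + 1))) * (1 / (real N + c))
      + c * (s + c) * (1 / real N ^ (k + 2) * (1 / (real N + c)))) \<in> O(\<lambda>N. 1 / real N ^ (k + 3))" .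
  have "\<forall>\<^sub>F N in sequentially. real N > \<bar>c\<bar>" by real_asymp
  then have "\<forall>\<^sub>F N in sequentially. g N / (real N + c) - (1 / real N ^ (k + 1) - (s + c) / real N ^ (k + 2))
    = (g N - (1 / real N ^ k - s / real N ^ (k + 1))) * (1 / (real N + c))
      + c * (s + c) * (1 / real N ^ (k + 2) * (1 / (real N + c)))"
  proof eventually_elim
    case (elim N)
    then have "real N \<noteq> 0" "real N + c \<noteq> 0" by linarith+
    then have "(1 / real N ^ k - s / real N ^ (k + 1)) * (1 / (real N + c))
      = 1 / real N ^ (k + 1) - (s + c) / real N ^ (k + 2) + c * (s + c) * (1 / real N ^ (k + 2) * (1 / (real N + c)))"
      by (simp add: divide_simps) (simp add: algebra_simps)
    then show ?case by (simp only: left_diff_distrib) simp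
  qed
  then show ?thesis using R by (subst landau_o.big.in_cong)
qed

text \<open>The second coefficient accumulates the shifts 0 + 1 + ... + (n - 1).\<close>

lemma expansion_inverse_prod:
  "(\<lambda>N. 1 / (\<Prod>m<n. real N + real m) - (1 / real N ^ n - real n * (real n - 1) / 2 / real N ^ (n + 1)))
    \<in> O(\<lambda>N. 1 / real N ^ (n + 2))"
proof (induction n)
  case (Suc n)
  have "real n * (real n - 1) / 2 + real n = real (Suc n) * (real (Suc n) - 1) / 2"
    by (simp add: field_simps)
  with expansion_divide_shift[OF Suc, of "real n"] show ?case
    by (simp add: eval_nat_numeral del: of_nat_Suc)
qed simp

theorem theorem1p2:
  fixes i j n :: nat
    and M :: "nat \<Rightarrow> 'a measure"
    and V :: "nat \<Rightarrow> 'a \<Rightarrow> complex mat"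
  assumes "i \<ge> 1" and "j \<ge> 1" and "n \<ge> 1" and "i \<noteq> j"
    and "\<And>N. N \<ge> 1 \<Longrightarrow> COE N (M N) (V N)"
  shows "(\<lambda>N. (\<integral>\<omega>. (cmod (V N \<omega> $$ (i - 1, j - 1))) ^ (2 * n) \<partial>(M N))
            - fact n * (1 / real N ^ n - real n * (real n + 1) / 2 * (1 / real N ^ (n + 1))))
         \<in> O(\<lambda>N. 1 / real N ^ (n + 2))"
proof -
  obtain m where n: "n = Suc m" using \<open>n \<ge> 1\<close> by (cases n) auto
  define P where "P = (\<lambda>N. \<Prod>k<m. real N + real k)"
  \<comment> \<open>The total of all shifts: 0, ..., m - 1 from the product and 2 m + 1 from the
    isolated factor.\<close>
  have c: "real m * (real m - 1) / 2 + real (2 * m + 1) = real n * (real n + 1) / 2"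
    by (simp add: n field_simps)
  have "(\<lambda>N. 1 / P N / (real N + real (2 * m + 1)) - (1 / real N ^ n - real n * (real n + 1) / 2 / real N ^ (n + 1)))
    \<in> O(\<lambda>N. 1 / real N ^ (n + 2))"
    using expansion_divide_shift[OF expansion_inverse_prod[of m], of "real (2 * m + 1)"]
    unfolding c by (simp add: n P_def eval_nat_numeral del: of_nat_Suc)
  then have R: "(\<lambda>N. fact n * (1 / P N / (real N + real (2 * m + 1)) - (1 / real N ^ n - real n * (real n + 1) / 2 / real N ^ (n + 1))))
    \<in> O(\<lambda>N. 1 / real N ^ (n + 2))"
    by simp
  have "\<forall>\<^sub>F N in sequentially. (\<integral>\<omega>. (cmod (V N \<omega> $$ (i - 1, j - 1))) ^ (2 * n) \<partial>(M N))
      - fact n * (1 / real N ^ n - real n * (real n + 1) / 2 * (1 / real N ^ (n + 1)))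
    = fact n * (1 / P N / (real N + real (2 * m + 1)) - (1 / real N ^ n - real n * (real n + 1) / 2 / real N ^ (n + 1)))"
    \<comment> \<open>From this size on the entry exists. The indices \<open>i\<close>,
      \<open>j\<close> count from 1 and matrix positions from 0; as both are positive, the truncated
      subtraction keeps them distinct.\<close>
    using eventually_ge_at_top[of "max i j"]
  proof eventually_elim
    case (elim N)
    then have "COE N (M N) (V N)" "i - 1 < N" "j - 1 < N" "i - 1 \<noteq> j - 1"
      using assms by auto
    from COE_offdiagonal_moment[OF this, of m] show ?case
      unfolding n P_def by (simp add: right_diff_distrib del: fact_Suc of_nat_Suc power_Suc)
  qed
  then show ?thesis using R by (subst landau_o.big.in_cong)
qed

end
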